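(* Let $d\geq 2$ be an integer, let $T:\mathbb{Z}^d\curvearrowright(X,\mu)$ be a totally ergodic probability preserving action and let $f\in L^2(\mu)$. Then, in $L^2(\mu)$, $$\lim_{N\to\infty}\frac{1}{|Q_N^{\mathcal P}|}\sum_{v\in Q_N^{\mathcal P}}T_vf=\int_X f\,d\mu .$$ Moreover, if $A\subset X$ is measurable with $\mu(A)>0$, then for every $\varepsilon>0$, $$\underline d_{Q_N^{\mathcal P}}\Big(\big\{v\in\mathcal P:\ \mu(A\cap T_vA)>\mu(A)^2-\varepsilon\big\}\Big)>0 .$$
   Context: A probability preserving action $T:\mathbb{Z}^d\curvearrowright(X,\mu)$ is a measurable action $v\mapsto T_v$ of $\mathbb{Z}^d$ on a probability space $(X,\mu)$ by measure-preserving transformations; $L^2(\mu)$ is assumed separable. For a function $f$, $T_vf=f\circ T_v^{-1}$ (so $T_v\mathbf 1_A=\mathbf 1_{T_vA}$). The action is totally ergodic if $\mathbb{Z}^d$ and all of its finite index subgroups act ergodically. $Q_N=[-N,N]^d\cap\mathbb{Z}^d$. A non-zero vector $v\in\mathbb{Z}^d$ is primitive if the greatest common divisor of its non-zero components is $1$; $\mathcal P\subset\mathbb{Z}^d$ is the set of primitive vectors and $Q_N^{\mathcal P}=Q_N\cap\mathcal P$. For $E\subset\mathbb{Z}^d$, $$\underline d_{Q_N^{\mathcal P}}(E)=\liminf_{N\to\infty}\frac{|E\cap Q_N^{\mathcal P}|}{|Q_N^{\mathcal P}|}.$$ *)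

theory Defs
  imports "HOL-Probability.Probability"
begin

text \<open>
  The group \<open>\<int>\<^sup>d\<close> is the additive group of the type \<open>int ^ 'd\<close>, with \<open>d = CARD('d)\<close>.
\<close>

definition L2 :: "'a measure \<Rightarrow> ('a \<Rightarrow> complex) set" where
  "L2 M = {f. f \<in> borel_measurable M \<and> integrable M (\<lambda>x. (norm (f x))\<^sup>2)}"

definition L2_norm :: "'a measure \<Rightarrow> ('a \<Rightarrow> complex) \<Rightarrow> real" where
  "L2_norm M f = sqrt (\<integral>x. (norm (f x))\<^sup>2 \<partial>M)"

text \<open>
  Elements of \<open>L2 M\<close> are functions, not classes modulo null sets, so \<open>L2_norm\<close> is a seminorm
  on them. Membership is part of convergence because the Bochner integral of a non-integrable
  function is \<open>0\<close>.
\<close>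

definition L2_converges :: "'a measure \<Rightarrow> (nat \<Rightarrow> 'a \<Rightarrow> complex) \<Rightarrow> ('a \<Rightarrow> complex) \<Rightarrow> bool" where
  "L2_converges M F g \<longleftrightarrow>
     (\<forall>N. F N \<in> L2 M) \<and> g \<in> L2 M \<and> (\<lambda>N. L2_norm M (\<lambda>x. F N x - g x)) \<longlonglongrightarrow> 0"

definition L2_separable :: "'a measure \<Rightarrow> bool" where
  "L2_separable M \<longleftrightarrow>
     (\<exists>D. countable D \<and> D \<subseteq> L2 M \<and>
        (\<forall>f\<in>L2 M. \<forall>\<epsilon>>0. \<exists>g\<in>D. L2_norm M (\<lambda>x. f x - g x) < \<epsilon>))"

locale pp_action = prob_space M
  for M :: "'a measure" and T :: "int ^ 'd \<Rightarrow> 'a \<Rightarrow> 'a" +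
  assumes measurable_T [measurable]: "T v \<in> measurable M M"
    and distr_T: "distr M M (T v) = M"
    and T_zero: "x \<in> space M \<Longrightarrow> T 0 x = x"
    and T_add: "x \<in> space M \<Longrightarrow> T (u + v) x = T u (T v x)"
    and separable: "L2_separable M"

definition finite_index_subgroup :: "(int ^ 'd) set \<Rightarrow> bool" where
  "finite_index_subgroup H \<longleftrightarrow>
     0 \<in> H \<and> (\<forall>u\<in>H. \<forall>v\<in>H. u + v \<in> H) \<and> (\<forall>v\<in>H. - v \<in> H) \<and>
     finite (range (\<lambda>v. (\<lambda>h. v + h) ` H))"

definition acts_ergodically ::
    "'a measure \<Rightarrow> (int ^ 'd \<Rightarrow> 'a \<Rightarrow> 'a) \<Rightarrow> (int ^ 'd) set \<Rightarrow> bool" where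
  "acts_ergodically M T H \<longleftrightarrow>
     (\<forall>A\<in>sets M. (\<forall>v\<in>H. T v ` A = A) \<longrightarrow> measure M A = 0 \<or> measure M A = 1)"

definition totally_ergodic :: "'a measure \<Rightarrow> (int ^ 'd \<Rightarrow> 'a \<Rightarrow> 'a) \<Rightarrow> bool" where
  "totally_ergodic M T \<longleftrightarrow>
     acts_ergodically M T UNIV \<and> (\<forall>H. finite_index_subgroup H \<longrightarrow> acts_ergodically M T H)"

text \<open>
  The action on functions, \<open>T\<^sub>v f = f \<circ> T\<^sub>v\<^sup>-\<^sup>1\<close>. For an action, \<open>T\<^sub>v\<^sup>-\<^sup>1\<close> is \<open>T (- v)\<close>;
  see \<open>T_inverse\<close> below.
\<close>

definition translate :: "(int ^ 'd \<Rightarrow> 'a \<Rightarrow> 'a) \<Rightarrow> int ^ 'd \<Rightarrow> ('a \<Rightarrow> complex) \<Rightarrow> 'a \<Rightarrow> complex" where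
  "translate T v f = f \<circ> T (- v)"

context pp_action
begin

lemma T_in_space: "x \<in> space M \<Longrightarrow> T v x \<in> space M"
  using measurable_T by (rule measurable_space)

lemma T_minus:
  assumes "x \<in> space M"
  shows "T (- v) (T v x) = x" and "T v (T (- v) x) = x"
  using T_add[OF assms, of "- v" v] T_add[OF assms, of v "- v"] T_zero[OF assms] by simp_all

lemma bij_betw_T: "bij_betw (T v) (space M) (space M)"
  by (rule bij_betw_byWitness[where f' = "T (- v)"]) (auto simp: T_minus T_in_space)

lemma T_inverse: "x \<in> space M \<Longrightarrow> inv_into (space M) (T v) x = T (- v) x"
  using bij_betw_T[of v] by (intro inv_into_f_eq) (auto simp: bij_betw_def T_minus T_in_space)

end

definition Q :: "nat \<Rightarrow> (int ^ 'd) set" where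
  "Q N = {v. \<forall>i. \<bar>v $ i\<bar> \<le> int N}"

definition primitive_vectors :: "(int ^ 'd) set" where
  "primitive_vectors = {v. v \<noteq> 0 \<and> Gcd {v $ i | i. v $ i \<noteq> 0} = 1}"

definition QP :: "nat \<Rightarrow> (int ^ 'd) set" where
  "QP N = Q N \<inter> primitive_vectors"

text \<open>
  The quotient below is \<open>0 / 0 = 0\<close> at \<open>N = 0\<close>, which does not affect the lower limit.
\<close>

definition lower_density_QP :: "(int ^ 'd) set \<Rightarrow> ereal" where
  "lower_density_QP E =
     liminf (\<lambda>N. ereal (real (card (E \<inter> QP N)) / real (card (QP N :: (int ^ 'd) set))))"

definition primitive_average ::
    "(int ^ 'd \<Rightarrow> 'a \<Rightarrow> 'a) \<Rightarrow> ('a \<Rightarrow> complex) \<Rightarrow> nat \<Rightarrow> 'a \<Rightarrow> complex" where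
  "primitive_average T f N x =
     (\<Sum>v\<in>QP N. translate T v f x) / of_nat (card (QP N :: (int ^ 'd) set))"

end

theory Submission
  imports Defs
begin

text \<open>
  The primitive vectors are approximated by periodic sets. Fix \<open>K \<ge> 2\<close> and let \<open>sifted K\<close> be the set of
  vectors that are not divisible by any \<open>k\<close> with \<open>2 \<le> k \<le> K\<close>. It contains all primitive vectors,
  it is periodic modulo \<open>fact K\<close>, and a vector of \<open>sifted K\<close> that is not primitive is divisible by
  some \<open>k > K\<close>. In the cube \<open>Q N\<close> the non-zero multiples of \<open>k\<close> number at most \<open>(3 N / k) ^ d\<close>, and
  since \<open>d \<ge> 2\<close> the sum over \<open>k > K\<close> is \<open>O (N ^ d / K)\<close> (\<open>card_large_multiples\<close>). The same bound
  shows that \<open>QP N\<close> fills at least the fraction \<open>1 / 9 ^ d\<close> of the cube (\<open>card_Q_le_card_QP\<close>), so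
  averages over \<open>QP N\<close> are controlled by averages over \<open>Q N \<inter> sifted K\<close> with an error that
  vanishes as \<open>K\<close> grows, uniformly in \<open>N\<close> (\<open>L2_norm_orbit_sum_QP\<close>).

  For a set \<open>D\<close> that is periodic under a subgroup \<open>H\<close> acting ergodically, the sums of \<open>translate T v f\<close>
  over \<open>Q N \<inter> D\<close>, divided by \<open>card (Q N)\<close>, tend to \<open>0\<close> when \<open>f\<close> has mean zero
  (\<open>periodic_mean_ergodic\<close>). The argument is the Hilbert space proof of the mean ergodic theorem:
  periodicity of \<open>D\<close> makes \<open>f\<close> and \<open>translate T u f\<close>, for \<open>u\<close> in \<open>H\<close>, have asymptotically equal
  averages, so the functions of mean zero with the same asymptotic averages as \<open>f\<close> form a closed
  convex \<open>H\<close>-invariant set, whose element of minimal norm is \<open>H\<close>-invariant and therefore zero. Total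
  ergodicity provides this for the finite index subgroup of multiples of \<open>fact K\<close>.

  For the recurrence statement, pairing the averages of the indicator function of \<open>A\<close> with that
  function shows that the averages of \<open>measure M (A \<inter> T v ` A)\<close> tend to \<open>(measure M A)\<^sup>2\<close>. As these
  correlations are at most \<open>1\<close>, their averages cannot have this limit if they fall short of it by \<open>\<epsilon>\<close>
  outside a set of lower density zero.
\<close>

section \<open>The seminormed space of square-integrable functions\<close>

lemma L2_measurable: "f \<in> L2 M \<Longrightarrow> f \<in> borel_measurable M"
  by (simp add: L2_def)

lemma L2_integrable_sq: "f \<in> L2 M \<Longrightarrow> integrable M (\<lambda>x. (norm (f x))\<^sup>2)"
  by (simp add: L2_def)

lemma L2_norm_nonneg [simp]: "L2_norm M f \<ge> 0"
  by (simp add: L2_norm_def)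

lemma L2_norm_sq: "(L2_norm M f)\<^sup>2 = (\<integral>x. (norm (f x))\<^sup>2 \<partial>M)"
  by (simp add: L2_norm_def)

lemma L2_bound:
  assumes "f \<in> L2 M" "g \<in> borel_measurable M" "\<And>x. norm (g x) \<le> c * norm (f x)"
  shows "g \<in> L2 M"
proof -
  have "(norm (g x))\<^sup>2 \<le> c\<^sup>2 * (norm (f x))\<^sup>2" for x
    using power_mono[OF assms(3)[of x], of 2] by (simp add: power_mult_distrib)
  hence "integrable M (\<lambda>x. (norm (g x))\<^sup>2)"
    using assms(2) by (intro Bochner_Integration.integrable_bound
        [OF integrable_mult_right[OF L2_integrable_sq[OF assms(1)], of "c\<^sup>2"]]) auto
  thus ?thesis using assms(2) by (simp add: L2_def)
qed

lemma L2_cmult: "f \<in> L2 M \<Longrightarrow> (\<lambda>x. c * f x) \<in> L2 M"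
  by (rule L2_bound[where f = f and c = "norm c"]) (auto simp: norm_mult dest: L2_measurable)

lemma L2_add:
  assumes "f \<in> L2 M" "g \<in> L2 M"
  shows "(\<lambda>x. f x + g x) \<in> L2 M"
proof -
  note [measurable] = assms[THEN L2_measurable]
  have "(norm (f x + g x))\<^sup>2 \<le> 2 * (norm (f x))\<^sup>2 + 2 * (norm (g x))\<^sup>2" for x
  proof -
    have "(norm (f x + g x))\<^sup>2 \<le> (norm (f x) + norm (g x))\<^sup>2"
      by (intro power_mono norm_triangle_ineq) auto
    also have "\<dots> \<le> 2 * (norm (f x))\<^sup>2 + 2 * (norm (g x))\<^sup>2"
      using sum_squares_bound[of "norm (f x)" "norm (g x)"] by (simp add: power2_sum)
    finally show ?thesis .
  qed
  hence bound: "norm ((norm (f x + g x))\<^sup>2) \<le> norm (2 * (norm (f x))\<^sup>2 + 2 * (norm (g x))\<^sup>2)" for x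
    by simp
  have "integrable M (\<lambda>x. 2 * (norm (f x))\<^sup>2 + 2 * (norm (g x))\<^sup>2)"
    by (rule Bochner_Integration.integrable_add[OF integrable_mult_right[OF L2_integrable_sq[OF assms(1)]]
          integrable_mult_right[OF L2_integrable_sq[OF assms(2)]]])
  moreover have "(\<lambda>x. (norm (f x + g x))\<^sup>2) \<in> borel_measurable M" by measurable
  ultimately have "integrable M (\<lambda>x. (norm (f x + g x))\<^sup>2)"
    by (rule Bochner_Integration.integrable_bound[OF _ _ AE_I2[OF bound]])
  thus ?thesis by (simp add: L2_def)
qed

lemma L2_diff: "f \<in> L2 M \<Longrightarrow> g \<in> L2 M \<Longrightarrow> (\<lambda>x. f x - g x) \<in> L2 M"
  using L2_add[of f M "\<lambda>x. (-1) * g x"] L2_cmult[of g M "-1"] by simp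

lemma L2_zero: "(\<lambda>_. 0) \<in> L2 M"
  by (simp add: L2_def)

lemma L2_sum: "(\<And>i. i \<in> S \<Longrightarrow> f i \<in> L2 M) \<Longrightarrow> (\<lambda>x. \<Sum>i\<in>S. f i x) \<in> L2 M"
  by (induction S rule: infinite_finite_induct) (auto simp: L2_zero intro: L2_add)

lemma (in prob_space) L2_const: "(\<lambda>_. c) \<in> L2 M"
  by (simp add: L2_def)

lemma L2_Cauchy_Schwarz:
  assumes "f \<in> L2 M" "g \<in> L2 M"
  shows "integrable M (\<lambda>x. norm (f x) * norm (g x))"
    and "(\<integral>x. norm (f x) * norm (g x) \<partial>M) \<le> L2_norm M f * L2_norm M g"
proof -
  note [measurable] = assms[THEN L2_measurable]
  show int: "integrable M (\<lambda>x. norm (f x) * norm (g x))"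
  proof (rule Bochner_Integration.integrable_bound)
    show "integrable M (\<lambda>x. (norm (f x))\<^sup>2 + (norm (g x))\<^sup>2)"
      by (rule Bochner_Integration.integrable_add[OF assms[THEN L2_integrable_sq]])
    have "norm (norm (f x) * norm (g x)) \<le> norm ((norm (f x))\<^sup>2 + (norm (g x))\<^sup>2)" for x
      using sum_squares_bound[of "norm (f x)" "norm (g x)"]
            mult_nonneg_nonneg[OF norm_ge_zero[of "f x"] norm_ge_zero[of "g x"]]
      unfolding real_norm_def by linarith
    thus "AE x in M. norm (norm (f x) * norm (g x)) \<le> norm ((norm (f x))\<^sup>2 + (norm (g x))\<^sup>2)"
      by (rule AE_I2)
  qed measurable
  define I where "I = (\<integral>x. norm (f x) * norm (g x) \<partial>M)"
  have "I \<ge> 0" by (simp add: I_def)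
  have "(\<integral>\<^sup>+x. ennreal (norm (f x)) * ennreal (norm (g x)) \<partial>M) = ennreal I"
    unfolding I_def using nn_integral_eq_integral[OF int] by (simp add: ennreal_mult)
  moreover have "(\<integral>\<^sup>+x. (ennreal (norm (h x)))\<^sup>2 \<partial>M) = ennreal ((L2_norm M h)\<^sup>2)"
    if "h \<in> L2 M" for h
    using nn_integral_eq_integral[OF L2_integrable_sq[OF that]]
    by (simp add: L2_norm_sq ennreal_power)
  ultimately have "(ennreal I)\<^sup>2 \<le> ennreal ((L2_norm M f)\<^sup>2) * ennreal ((L2_norm M g)\<^sup>2)"
    using Cauchy_Schwarz_nn_integral[of "\<lambda>x. ennreal (norm (f x))" M "\<lambda>x. ennreal (norm (g x))"] assms
    by simp
  also have "\<dots> = ennreal ((L2_norm M f * L2_norm M g)\<^sup>2)"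
    by (simp add: ennreal_mult power_mult_distrib)
  finally have "I\<^sup>2 \<le> (L2_norm M f * L2_norm M g)\<^sup>2"
    using \<open>I \<ge> 0\<close> by (simp add: ennreal_power)
  thus "I \<le> L2_norm M f * L2_norm M g"
    by (rule power2_le_imp_le) simp
qed

lemma L2_norm_add:
  assumes "f \<in> L2 M" "g \<in> L2 M"
  shows "L2_norm M (\<lambda>x. f x + g x) \<le> L2_norm M f + L2_norm M g"
proof (rule power2_le_imp_le)
  note int = assms[THEN L2_integrable_sq] L2_Cauchy_Schwarz(1)[OF assms]
  have "(L2_norm M (\<lambda>x. f x + g x))\<^sup>2
      \<le> (\<integral>x. (norm (f x))\<^sup>2 + (norm (g x))\<^sup>2 + 2 * (norm (f x) * norm (g x)) \<partial>M)"
    unfolding L2_norm_sq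
  proof (rule integral_mono)
    show "(norm (f x + g x))\<^sup>2 \<le> (norm (f x))\<^sup>2 + (norm (g x))\<^sup>2 + 2 * (norm (f x) * norm (g x))" for x
      using power_mono[OF norm_triangle_ineq[of "f x" "g x"], of 2] by (simp add: power2_sum)
  qed (use int L2_integrable_sq[OF L2_add[OF assms]] in auto)
  also have "\<dots> = (L2_norm M f)\<^sup>2 + (L2_norm M g)\<^sup>2 + 2 * (\<integral>x. norm (f x) * norm (g x) \<partial>M)"
    using int by (simp add: L2_norm_sq)
  also have "\<dots> \<le> (L2_norm M f + L2_norm M g)\<^sup>2"
    using L2_Cauchy_Schwarz(2)[OF assms] by (simp add: power2_sum)
  finally show "(L2_norm M (\<lambda>x. f x + g x))\<^sup>2 \<le> (L2_norm M f + L2_norm M g)\<^sup>2" .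
qed simp

lemma L2_norm_cmult: "L2_norm M (\<lambda>x. c * f x) = norm c * L2_norm M f"
  by (simp add: L2_norm_def norm_mult power_mult_distrib real_sqrt_mult)

lemma L2_norm_uminus: "L2_norm M (\<lambda>x. - f x) = L2_norm M f"
  by (simp add: L2_norm_def)

lemma L2_norm_diff:
  assumes "f \<in> L2 M" "g \<in> L2 M"
  shows "L2_norm M (\<lambda>x. f x - g x) \<le> L2_norm M f + L2_norm M g"
  using L2_norm_add[OF assms(1) L2_cmult[OF assms(2), of "-1"]]
  by (simp add: L2_norm_uminus)

lemma L2_norm_sum:
  assumes "\<And>i. i \<in> S \<Longrightarrow> f i \<in> L2 M"
  shows "L2_norm M (\<lambda>x. \<Sum>i\<in>S. f i x) \<le> (\<Sum>i\<in>S. L2_norm M (f i))"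
  using assms
proof (induction S rule: infinite_finite_induct)
  case (insert i S)
  have "L2_norm M (\<lambda>x. \<Sum>i\<in>insert i S. f i x) \<le> L2_norm M (f i) + L2_norm M (\<lambda>x. \<Sum>i\<in>S. f i x)"
    using L2_norm_add[of "f i" M "\<lambda>x. \<Sum>i\<in>S. f i x"] insert by (simp add: L2_sum)
  thus ?case using insert by simp
qed (simp_all add: L2_norm_def)

lemma L2_norm_cong_AE:
  assumes "f \<in> borel_measurable M" "g \<in> borel_measurable M" "AE x in M. f x = g x"
  shows "L2_norm M f = L2_norm M g"
  unfolding L2_norm_def using assms by (auto intro!: arg_cong[where f = sqrt] integral_cong_AE)

lemma L2_norm_cong: "(\<And>x. x \<in> space M \<Longrightarrow> f x = g x) \<Longrightarrow> L2_norm M f = L2_norm M g"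
  by (simp add: L2_norm_def cong: Bochner_Integration.integral_cong)

lemma L2_norm_eq_0_AE:
  assumes "f \<in> L2 M" "L2_norm M f = 0"
  shows "AE x in M. f x = 0"
  using integral_nonneg_eq_0_iff_AE[OF L2_integrable_sq[OF assms(1)]] assms(2)
  by (simp add: L2_norm_def)

lemma (in prob_space) L2_integrable:
  assumes "f \<in> L2 M"
  shows "integrable M f"
    and "(\<integral>x. norm (f x) \<partial>M) \<le> L2_norm M f"
    and "norm (\<integral>x. f x \<partial>M) \<le> L2_norm M f"
proof -
  note CS = L2_Cauchy_Schwarz[OF assms L2_const[of 1]]
  show "integrable M f"
    using CS(1) assms by (simp add: L2_measurable integrable_norm_iff)
  show 1: "(\<integral>x. norm (f x) \<partial>M) \<le> L2_norm M f"
    using CS(2) by (simp add: L2_norm_def prob_space)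
  show "norm (\<integral>x. f x \<partial>M) \<le> L2_norm M f"
    using integral_norm_bound[of M f] 1 by linarith
qed

text \<open>
  On a probability space, a sequence that is Cauchy in \<open>L\<^sup>2\<close> is Cauchy in \<open>L\<^sup>1\<close>, so a
  subsequence converges almost everywhere; Fatou's lemma upgrades this to convergence in \<open>L\<^sup>2\<close>
  of the whole sequence.
\<close>

lemma (in prob_space) L2_complete:
  assumes L2: "\<And>n. F n \<in> L2 M"
    and Cauchy: "\<And>e. e > 0 \<Longrightarrow> \<exists>N. \<forall>i\<ge>N. \<forall>j\<ge>N. L2_norm M (\<lambda>x. F i x - F j x) < e"
  obtains g where "g \<in> L2 M" "(\<lambda>n. L2_norm M (\<lambda>x. F n x - g x)) \<longlonglongrightarrow> 0"
proof -
  note [measurable] = L2[THEN L2_measurable]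
  have L1: "\<exists>N. \<forall>i\<ge>N. \<forall>j\<ge>N. (LINT x|M. norm (F i x - F j x)) < e" if "e > 0" for e
  proof -
    obtain N where "\<And>i j. i \<ge> N \<Longrightarrow> j \<ge> N \<Longrightarrow> L2_norm M (\<lambda>x. F i x - F j x) < e"
      using Cauchy[OF \<open>e > 0\<close>] by blast
    thus ?thesis
      by (intro exI[of _ N] allI impI le_less_trans[OF L2_integrable(2)[OF L2_diff[OF L2 L2]]])
  qed
  obtain r where r: "strict_mono r" and AE: "AE x in M. Cauchy (\<lambda>i. F (r i) x)"
    by (rule cauchy_L1_AE_cauchy_subseq[OF L2_integrable(1)[OF L2] L1])
  define g where "g x = lim (\<lambda>i. F (r i) x)" for x
  have [measurable]: "g \<in> borel_measurable M" unfolding g_def by measurable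
  have lim: "AE x in M. (\<lambda>i. F (r i) x) \<longlonglongrightarrow> g x"
    using AE unfolding g_def by (auto simp: Cauchy_convergent_iff convergent_LIMSEQ_iff)
  have close: "\<exists>N. \<forall>n\<ge>N. (\<lambda>x. F n x - g x) \<in> L2 M \<and> L2_norm M (\<lambda>x. F n x - g x) \<le> e"
    if "e > 0" for e
  proof -
    obtain N where N: "\<And>i j. i \<ge> N \<Longrightarrow> j \<ge> N \<Longrightarrow> L2_norm M (\<lambda>x. F i x - F j x) < e"
      using Cauchy[OF \<open>e > 0\<close>] by blast
    have "(\<lambda>x. F n x - g x) \<in> L2 M \<and> L2_norm M (\<lambda>x. F n x - g x) \<le> e" if n: "n \<ge> N" for n
    proof -
      have "(\<integral>\<^sup>+x. ennreal ((norm (F n x - g x))\<^sup>2) \<partial>M)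
          = (\<integral>\<^sup>+x. liminf (\<lambda>i. ennreal ((norm (F n x - F (r i) x))\<^sup>2)) \<partial>M)"
      proof (rule nn_integral_cong_AE, use lim in eventually_elim)
        fix x assume "(\<lambda>i. F (r i) x) \<longlonglongrightarrow> g x"
        hence "(\<lambda>i. ennreal ((norm (F n x - F (r i) x))\<^sup>2)) \<longlonglongrightarrow> ennreal ((norm (F n x - g x))\<^sup>2)"
          by (intro tendsto_ennrealI tendsto_intros)
        thus "ennreal ((norm (F n x - g x))\<^sup>2) = liminf (\<lambda>i. ennreal ((norm (F n x - F (r i) x))\<^sup>2))"
          by (rule lim_imp_Liminf[OF sequentially_bot, symmetric])
      qed
      also have "\<dots> \<le> liminf (\<lambda>i. \<integral>\<^sup>+x. ennreal ((norm (F n x - F (r i) x))\<^sup>2) \<partial>M)"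
        by (rule nn_integral_liminf) measurable
      also have "\<dots> \<le> ennreal (e\<^sup>2)"
      proof (rule Liminf_le[OF sequentially_bot],
          rule eventually_sequentiallyI[of N])
        fix i assume "i \<ge> N"
        hence "r i \<ge> N" using seq_suble[OF r, of i] by linarith
        hence "L2_norm M (\<lambda>x. F n x - F (r i) x) \<le> e" using N[OF n] by (simp add: less_imp_le)
        hence "(L2_norm M (\<lambda>x. F n x - F (r i) x))\<^sup>2 \<le> e\<^sup>2" by (intro power_mono) auto
        thus "(\<integral>\<^sup>+x. ennreal ((norm (F n x - F (r i) x))\<^sup>2) \<partial>M) \<le> ennreal (e\<^sup>2)"
          using nn_integral_eq_integral[OF L2_integrable_sq[OF L2_diff[OF L2 L2]], of n "r i"]
          by (simp add: L2_norm_sq ennreal_leI)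
      qed
      finally have le: "(\<integral>\<^sup>+x. ennreal ((norm (F n x - g x))\<^sup>2) \<partial>M) \<le> ennreal (e\<^sup>2)" .
      hence int: "integrable M (\<lambda>x. (norm (F n x - g x))\<^sup>2)"
        by (intro integrableI_bounded) (auto simp: le_less_trans)
      hence "(L2_norm M (\<lambda>x. F n x - g x))\<^sup>2 \<le> e\<^sup>2"
        using le nn_integral_eq_integral[OF int] by (simp add: L2_norm_sq)
      hence "L2_norm M (\<lambda>x. F n x - g x) \<le> e"
        using \<open>e > 0\<close> by (meson power2_le_imp_le less_imp_le)
      thus ?thesis using int by (simp add: L2_def)
    qed
    thus ?thesis by blast
  qed
  have "(\<lambda>n. L2_norm M (\<lambda>x. F n x - g x)) \<longlonglongrightarrow> 0"
  proof (rule LIMSEQ_I)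
    fix e :: real assume "e > 0"
    then obtain N where "\<And>n. n \<ge> N \<Longrightarrow> L2_norm M (\<lambda>x. F n x - g x) \<le> e / 2"
      using close[of "e / 2"] half_gt_zero by blast
    hence "norm (L2_norm M (\<lambda>x. F n x - g x) - 0) < e" if "n \<ge> N" for n
      using \<open>e > 0\<close> le_less_trans[of "L2_norm M (\<lambda>x. F n x - g x)" "e / 2" e] that by simp
    thus "\<exists>N. \<forall>n\<ge>N. norm (L2_norm M (\<lambda>x. F n x - g x) - 0) < e" by blast
  qed
  moreover have "g \<in> L2 M"
  proof -
    obtain n where "(\<lambda>x. F n x - g x) \<in> L2 M" using close[of 1] by auto
    from L2_diff[OF L2[of n] this] show ?thesis by simp
  qed
  ultimately show ?thesis using that by blast
qed

lemma L2_parallelogram: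
  assumes "f \<in> L2 M" "g \<in> L2 M"
  shows "(L2_norm M (\<lambda>x. f x - g x))\<^sup>2 =
    2 * (L2_norm M f)\<^sup>2 + 2 * (L2_norm M g)\<^sup>2 - 4 * (L2_norm M (\<lambda>x. (f x + g x) / 2))\<^sup>2"
proof -
  have "(norm (z - w))\<^sup>2 = 2 * (norm z)\<^sup>2 + 2 * (norm w)\<^sup>2 - 4 * (norm ((z + w) / 2))\<^sup>2"
    for z w :: complex
    unfolding cmod_power2 by (simp add: power2_eq_square field_simps)
  moreover have "integrable M (\<lambda>x. (norm ((f x + g x) / 2))\<^sup>2)"
    using L2_integrable_sq[OF L2_cmult[OF L2_add[OF assms], of "1/2"]] by simp
  ultimately show ?thesis
    using assms[THEN L2_integrable_sq] by (simp add: L2_norm_sq)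
qed

text \<open>
  A minimising sequence is Cauchy by the parallelogram identity, because the midpoint of two almost
  minimal elements cannot be shorter than the infimum. The same identity makes the minimiser unique
  almost everywhere.
\<close>

lemma (in prob_space) L2_minimal_norm:
  assumes sub: "C \<subseteq> L2 M" and ne: "C \<noteq> {}"
    and mid: "\<And>f g. f \<in> C \<Longrightarrow> g \<in> C \<Longrightarrow> (\<lambda>x. (f x + g x) / 2) \<in> C"
    and closed: "\<And>F g. (\<And>n. F n \<in> C) \<Longrightarrow> g \<in> L2 M \<Longrightarrow>
                   (\<lambda>n. L2_norm M (\<lambda>x. F n x - g x)) \<longlonglongrightarrow> 0 \<Longrightarrow> g \<in> C"
  obtains g where "g \<in> C"
    "\<And>h. h \<in> C \<Longrightarrow> L2_norm M h = L2_norm M g \<Longrightarrow> L2_norm M (\<lambda>x. h x - g x) = 0"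
proof -
  define m where "m = (INF f\<in>C. L2_norm M f)"
  have bdd: "bdd_below (L2_norm M ` C)" by (rule bdd_belowI2[where m = 0]) simp
  have m_le: "m \<le> L2_norm M f" if "f \<in> C" for f
    unfolding m_def by (rule cINF_lower[OF bdd that])
  have "m \<ge> 0" unfolding m_def using ne by (intro cINF_greatest) auto
  \<comment> \<open>Two elements of almost minimal norm are close to each other.\<close>
  have par: "(L2_norm M (\<lambda>x. f x - g x))\<^sup>2 \<le> 2 * (L2_norm M f)\<^sup>2 + 2 * (L2_norm M g)\<^sup>2 - 4 * m\<^sup>2"
    if "f \<in> C" "g \<in> C" for f g
  proof -
    have "m\<^sup>2 \<le> (L2_norm M (\<lambda>x. (f x + g x) / 2))\<^sup>2"
      using m_le[OF mid[OF that]] \<open>m \<ge> 0\<close> by (intro power_mono)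
    moreover have "f \<in> L2 M" "g \<in> L2 M" using that sub by auto
    ultimately show ?thesis using L2_parallelogram[of f M g] by linarith
  qed
  have "\<exists>f\<in>C. L2_norm M f < m + 1 / real (Suc n)" for n
    using cINF_less_iff[OF ne bdd, of "m + 1 / real (Suc n)"] by (simp add: m_def)
  then obtain F where F: "\<And>n. F n \<in> C" "\<And>n. L2_norm M (F n) < m + 1 / real (Suc n)"
    by metis
  have FL2: "F n \<in> L2 M" for n using F sub by auto
  have lim: "(\<lambda>n. L2_norm M (F n)) \<longlonglongrightarrow> m"
  proof (rule tendsto_sandwich[OF always_eventually always_eventually tendsto_const])
    show "(\<lambda>n. m + 1 / real (Suc n)) \<longlonglongrightarrow> m"
      using tendsto_add[OF tendsto_const LIMSEQ_inverse_real_of_nat, of m] by (simp add: inverse_eq_divide)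
  qed (use m_le F(1) less_imp_le[OF F(2)] in auto)
  have Cau: "\<exists>N. \<forall>i\<ge>N. \<forall>j\<ge>N. L2_norm M (\<lambda>x. F i x - F j x) < e" if "e > 0" for e
  proof -
    have "(\<lambda>n. (L2_norm M (F n))\<^sup>2) \<longlonglongrightarrow> m\<^sup>2" by (intro tendsto_intros lim)
    moreover have "e\<^sup>2 / 4 > 0" using that by simp
    ultimately obtain N where N: "\<And>n. n \<ge> N \<Longrightarrow> \<bar>(L2_norm M (F n))\<^sup>2 - m\<^sup>2\<bar> < e\<^sup>2 / 4"
      using LIMSEQ_D[of "\<lambda>n. (L2_norm M (F n))\<^sup>2" "m\<^sup>2"] by (metis real_norm_def)
    have "L2_norm M (\<lambda>x. F i x - F j x) < e" if "i \<ge> N" "j \<ge> N" for i j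
    proof (rule power2_less_imp_less)
      show "(L2_norm M (\<lambda>x. F i x - F j x))\<^sup>2 < e\<^sup>2"
        using par[OF F(1) F(1), of i j] N[OF that(1)] N[OF that(2)] by linarith
    qed (use \<open>e > 0\<close> in simp)
    thus ?thesis by blast
  qed
  obtain g where g: "g \<in> L2 M" "(\<lambda>n. L2_norm M (\<lambda>x. F n x - g x)) \<longlonglongrightarrow> 0"
    using L2_complete[OF FL2 Cau] by blast
  have "g \<in> C" by (rule closed[OF F(1) g])
  have "L2_norm M g \<le> L2_norm M (F n) + L2_norm M (\<lambda>x. F n x - g x)" for n
    using L2_norm_diff[OF FL2[of n] L2_diff[OF FL2[of n] g(1)]] by simp
  hence "L2_norm M g \<le> m + 0"
    by (intro LIMSEQ_le_const[OF tendsto_add[OF lim g(2)]]) auto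
  hence norm_g: "L2_norm M g = m" using m_le[OF \<open>g \<in> C\<close>] by simp
  show ?thesis
  proof (rule that[OF \<open>g \<in> C\<close>])
    fix h assume "h \<in> C" "L2_norm M h = L2_norm M g"
    thus "L2_norm M (\<lambda>x. h x - g x) = 0" using par[of h g] \<open>g \<in> C\<close> norm_g by simp
  qed
qed

section \<open>Counting lattice points in cubes\<close>

definition multiples :: "nat \<Rightarrow> (int ^ 'd) set" where
  "multiples k = {v. \<forall>i. int k dvd v $ i}"

definition dilate :: "nat \<Rightarrow> int ^ 'd \<Rightarrow> int ^ 'd" where
  "dilate k v = (\<chi> i. int k * v $ i)"

lemma Q_eq_vec_lambda: "Q N = vec_lambda ` (UNIV \<rightarrow> {- int N..int N})"
proof (intro equalityI subsetI)
  fix v :: "int ^ 'd" assume "v \<in> Q N"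
  hence "vec_nth v \<in> UNIV \<rightarrow> {- int N..int N}" by (auto simp: Q_def abs_le_iff)
       (metis minus_le_iff)
  thus "v \<in> vec_lambda ` (UNIV \<rightarrow> {- int N..int N})"
    by (metis image_eqI vec_nth_inverse)
qed (auto simp: Q_def abs_le_iff Pi_iff minus_le_iff)

lemma card_Q: "card (Q N :: (int ^ 'd) set) = (2 * N + 1) ^ CARD('d)"
  and finite_Q [simp]: "finite (Q N :: (int ^ 'd) set)"
proof -
  have inj: "inj_on (vec_lambda :: _ \<Rightarrow> int ^ 'd) S" for S
    by (rule inj_onI) (metis UNIV_I vec_lambda_inject)
  have eq: "(UNIV :: 'd set) \<rightarrow> {- int N..int N} = PiE UNIV (\<lambda>_. {- int N..int N})"
    by auto
  have card: "nat (2 * int N + 1) = Suc (2 * N)" by simp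
  show "card (Q N :: (int ^ 'd) set) = (2 * N + 1) ^ CARD('d)"
    unfolding Q_eq_vec_lambda card_image[OF inj] unfolding eq
    by (simp add: card_PiE card)
  show "finite (Q N :: (int ^ 'd) set)"
    unfolding Q_eq_vec_lambda eq by (intro finite_imageI finite_PiE) auto
qed

lemma finite_QP [simp]: "finite (QP N)"
  by (simp add: QP_def)

lemma Q_mono: "N \<le> N' \<Longrightarrow> (Q N :: (int ^ 'd) set) \<subseteq> Q N'"
  unfolding Q_def by (auto intro: order_trans)

lemma card_Q_pos: "card (Q N :: (int ^ 'd) set) > 0"
  by (simp add: card_Q)

lemma dilate_in_multiples: "dilate k v \<in> multiples k"
  by (simp add: dilate_def multiples_def)

lemma multiplesE:
  assumes "v \<in> multiples k"
  obtains w where "v = dilate k w"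
proof -
  have "v = dilate k (\<chi> i. v $ i div int k)"
    using assms by (auto simp: multiples_def dilate_def vec_eq_iff)
  thus ?thesis using that by blast
qed

lemma dilate_in_Q:
  assumes "k > 0" "dilate k w \<in> Q N"
  shows "w \<in> Q (N div k)"
proof -
  have "\<bar>w $ i\<bar> \<le> int (N div k)" for i
  proof -
    have "\<bar>int k * w $ i\<bar> \<le> int N" using assms(2) by (simp add: Q_def dilate_def)
    hence "\<bar>w $ i\<bar> * int k \<le> int N" by (simp add: abs_mult mult.commute)
    hence "\<bar>w $ i\<bar> * int k div int k \<le> int N div int k" using assms(1) by (intro zdiv_mono1) auto
    thus ?thesis using assms(1) by (simp add: zdiv_int)
  qed
  thus ?thesis by (simp add: Q_def)
qed

text \<open>
  Divisibility of a vector by \<open>k\<close> is divisibility of the greatest common divisor of its non-zero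
  entries by \<open>k\<close>; \<open>k = 0\<close> divides only the zero vector.
\<close>

lemma primitive_iff:
  "v \<in> primitive_vectors \<longleftrightarrow> v \<noteq> 0 \<and> (\<forall>k. v \<in> multiples k \<longrightarrow> k = 1)"
proof (cases "v = 0")
  case True
  thus ?thesis by (simp add: primitive_vectors_def)
next
  case False
  define G where "G = Gcd {v $ i | i. v $ i \<noteq> 0}"
  have dvd_G: "v \<in> multiples k \<longleftrightarrow> int k dvd G" for k
  proof
    assume "int k dvd G"
    moreover have "G dvd v $ i" for i unfolding G_def by (cases "v $ i = 0") (auto intro: Gcd_dvd)
    ultimately show "v \<in> multiples k" unfolding multiples_def by (auto intro: dvd_trans)
  qed (auto simp: G_def multiples_def intro: Gcd_greatest)
  have "G \<ge> 0" by (simp add: G_def)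
  have "G = 1 \<longleftrightarrow> (\<forall>k. int k dvd G \<longrightarrow> k = 1)"
  proof
    assume *: "\<forall>k. int k dvd G \<longrightarrow> k = 1"
    show "G = 1" using *[rule_format, of "nat G"] \<open>G \<ge> 0\<close> by simp
  qed simp
  thus ?thesis using False by (simp add: primitive_vectors_def G_def[symmetric] dvd_G)
qed

lemma dilate_primitiveE:
  assumes "v \<noteq> 0"
  obtains k w where "k > 0" "w \<in> primitive_vectors" "v = dilate k w"
proof -
  obtain i where i: "v $ i \<noteq> 0" using assms by (auto simp: vec_eq_iff)
  have bound: "k \<le> nat \<bar>v $ i\<bar>" if "v \<in> multiples k" for k
    using that i dvd_imp_le_int[of "v $ i" "int k"] by (auto simp: multiples_def)
  have one: "v \<in> multiples 1" by (simp add: multiples_def)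
  obtain k where k: "v \<in> multiples k" and max: "\<And>j. v \<in> multiples j \<Longrightarrow> j \<le> k"
    using Nat.ex_has_greatest_nat[of "\<lambda>k. v \<in> multiples k" 1 "nat \<bar>v $ i\<bar>"] one bound by blast
  obtain w where w: "v = dilate k w" using k by (rule multiplesE)
  have "k > 0" "w \<noteq> 0" using w assms by (auto simp: dilate_def vec_eq_iff intro: gr0I)
  moreover have "j = 1" if "w \<in> multiples j" for j
  proof -
    obtain u where "w = dilate j u" using \<open>w \<in> multiples j\<close> by (rule multiplesE)
    hence "v = dilate (k * j) u" using w by (simp add: dilate_def vec_eq_iff)
    hence "k * j \<le> k" using max dilate_in_multiples by metis
    moreover have "j \<noteq> 0" using \<open>w = dilate j u\<close> \<open>w \<noteq> 0\<close> by (auto simp: dilate_def vec_eq_iff)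
    ultimately show ?thesis using \<open>k > 0\<close> by simp
  qed
  ultimately show ?thesis using that[OF _ _ w] by (simp add: primitive_iff)
qed

text \<open>
  Comparison with the telescoping series of \<open>1 / (n (n + 1))\<close>.
\<close>

lemma sum_inverse_squares_tail:
  assumes "K > 0"
  shows "(\<Sum>k\<in>{K<..N}. 1 / (real k)\<^sup>2) \<le> 1 / real K"
proof -
  have "(\<Sum>k\<in>{K<..N}. 1 / (real k)\<^sup>2) \<le> 1 / real K - 1 / real N" if "K \<le> N"
    using that
  proof (induction N rule: dec_induct)
    case (step n)
    have "n > 0" using step assms by simp
    have "1 / (real (Suc n))\<^sup>2 \<le> 1 / real n - 1 / real (Suc n)"
    proof -
      have "1 / (real (Suc n))\<^sup>2 \<le> 1 / (real n * real (Suc n))"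
        using \<open>n > 0\<close> by (intro divide_left_mono) (auto simp: power2_eq_square)
      also have "\<dots> = 1 / real n - 1 / real (Suc n)" using \<open>n > 0\<close> by (simp add: field_simps)
      finally show ?thesis .
    qed
    moreover have "{K<..Suc n} = insert (Suc n) {K<..n}" using step by auto
    ultimately show ?case using step by simp
  qed simp
  thus ?thesis by (cases "K \<le> N") (auto intro: order_trans)
qed

text \<open>
  This is where \<open>d \<ge> 2\<close> enters: the multiples of \<open>k\<close> have density \<open>1 / k ^ d\<close>, which is summable
  over \<open>k\<close>. Excluding the zero vector limits the sum to \<open>k \<le> N\<close>, where the cube of side
  \<open>2 (N div k) + 1\<close> is bounded by that of side \<open>3 N / k\<close>.
\<close>

lemma card_large_multiples:
  assumes d: "CARD('d) \<ge> 2" and K: "K > 0"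
  shows "real (card {v \<in> Q N :: (int ^ 'd) set. v \<noteq> 0 \<and> (\<exists>k>K. v \<in> multiples k)})
    \<le> (3 * real N) ^ CARD('d) / real K" (is "real (card ?S) \<le> _")
proof -
  let ?d = "CARD('d)"
  have "?S \<subseteq> (\<Union>k\<in>{K<..N}. dilate k ` Q (N div k))"
  proof
    fix v assume "v \<in> ?S"
    then obtain k where v: "v \<in> Q N" "v \<noteq> 0" "k > K" "v \<in> multiples k" by auto
    obtain i where i: "v $ i \<noteq> 0" using v(2) by (auto simp: vec_eq_iff)
    have "int k \<le> \<bar>v $ i\<bar>" using v(4) i dvd_imp_le_int[of "v $ i" "int k"] by (auto simp: multiples_def)
    moreover have "\<bar>v $ i\<bar> \<le> int N" using v(1) by (simp add: Q_def)
    ultimately have "k \<le> N" by linarith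
    moreover obtain w where "v = dilate k w" using v(4) by (rule multiplesE)
    moreover have "w \<in> Q (N div k)" using dilate_in_Q[of k w N] v calculation by auto
    ultimately show "v \<in> (\<Union>k\<in>{K<..N}. dilate k ` Q (N div k))" using v(3) by auto
  qed
  hence "card ?S \<le> card (\<Union>k\<in>{K<..N}. dilate k ` (Q (N div k) :: (int ^ 'd) set))"
    by (intro card_mono) auto
  also have "\<dots> \<le> (\<Sum>k\<in>{K<..N}. card (dilate k ` (Q (N div k) :: (int ^ 'd) set)))"
    by (rule card_UN_le) simp
  also have "\<dots> \<le> (\<Sum>k\<in>{K<..N}. (2 * (N div k) + 1) ^ ?d)"
    by (intro sum_mono order_trans[OF card_image_le]) (auto simp: card_Q)
  finally have "real (card ?S) \<le> real (\<Sum>k\<in>{K<..N}. (2 * (N div k) + 1) ^ ?d)"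
    by (rule of_nat_mono)
  also have "\<dots> = (\<Sum>k\<in>{K<..N}. (2 * real (N div k) + 1) ^ ?d)" by (simp add: add.commute)
  also have "\<dots> \<le> (\<Sum>k\<in>{K<..N}. (3 * real N) ^ ?d * (1 / (real k)\<^sup>2))"
  proof (rule sum_mono)
    fix k assume k: "k \<in> {K<..N}"
    have "real (N div k) \<le> real N / real k" by (rule of_nat_div_le_of_nat)
    moreover have "1 \<le> real N / real k" using k by auto
    ultimately have "(2 * real (N div k) + 1) ^ ?d \<le> (3 * real N / real k) ^ ?d"
      by (intro power_mono) auto
    also have "\<dots> = (3 * real N) ^ ?d / real k ^ ?d" by (simp add: power_divide)
    also have "\<dots> \<le> (3 * real N) ^ ?d / (real k)\<^sup>2"
      using k d by (intro divide_left_mono power_increasing) auto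
    finally show "(2 * real (N div k) + 1) ^ ?d \<le> (3 * real N) ^ ?d * (1 / (real k)\<^sup>2)" by simp
  qed
  also have "\<dots> = (3 * real N) ^ ?d * (\<Sum>k\<in>{K<..N}. 1 / (real k)\<^sup>2)"
    by (simp add: sum_distrib_left)
  also have "\<dots> \<le> (3 * real N) ^ ?d * (1 / real K)"
    by (intro mult_left_mono sum_inverse_squares_tail K) auto
  finally show ?thesis by simp
qed

text \<open>
  Primitive vectors have positive lower density. Every non-zero vector of the cube is a dilate of
  a primitive one, and at most half of them need a factor larger than \<open>3 ^ d\<close>; each smaller factor
  accounts for at most \<open>card (QP N)\<close> vectors.
\<close>

lemma card_Q_le_card_QP:
  assumes d: "CARD('d) \<ge> 2" and N: "N > 0"
  shows "card (Q N :: (int ^ 'd) set) \<le> 9 ^ CARD('d) * card (QP N :: (int ^ 'd) set)"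
proof -
  let ?d = "CARD('d)"
  \<comment> \<open>Chosen to turn the bound \<open>(3 N) ^ d / K\<close> on the multiples by large factors into \<open>N ^ d\<close>.\<close>
  define K :: nat where "K = 3 ^ ?d"
  define L where "L = {v \<in> Q N :: (int ^ 'd) set. v \<noteq> 0 \<and> (\<exists>k>K. v \<in> multiples k)}"
  have "Q N \<subseteq> insert 0 (L \<union> (\<Union>k\<in>{1..K}. dilate k ` QP N))"
  proof
    fix v :: "int ^ 'd" assume v: "v \<in> Q N"
    show "v \<in> insert 0 (L \<union> (\<Union>k\<in>{1..K}. dilate k ` QP N))"
    proof (cases "v = 0")
      case False
      then obtain k w where kw: "k > 0" "w \<in> primitive_vectors" "v = dilate k w"
        by (rule dilate_primitiveE)
      have "w \<in> QP N"
        using dilate_in_Q[of k w N] v kw Q_mono[of "N div k" N] by (auto simp: QP_def)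
      thus ?thesis
        using kw v False dilate_in_multiples[of k w] by (cases "k \<le> K") (auto simp: L_def)
    qed simp
  qed
  moreover have "finite L" unfolding L_def by simp
  ultimately have "card (Q N :: (int ^ 'd) set)
      \<le> card (insert 0 (L \<union> (\<Union>k\<in>{1..K}. dilate k ` (QP N :: (int ^ 'd) set))))"
    by (intro card_mono) auto
  also have "\<dots> \<le> Suc (card L + card (\<Union>k\<in>{1..K}. dilate k ` (QP N :: (int ^ 'd) set)))"
    by (rule card_insert_le_m1) (simp_all add: card_Un_le)
  also have "card (\<Union>k\<in>{1..K}. dilate k ` (QP N :: (int ^ 'd) set))
      \<le> (\<Sum>k\<in>{1..K}. card (dilate k ` (QP N :: (int ^ 'd) set)))"
    by (rule card_UN_le) simp
  also have "\<dots> \<le> (\<Sum>k\<in>{1..K}. card (QP N :: (int ^ 'd) set))"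
    by (intro sum_mono card_image_le) simp
  also have "\<dots> = K * card (QP N :: (int ^ 'd) set)" by simp
  finally have "real (card (Q N :: (int ^ 'd) set))
      \<le> real (Suc (card L + K * card (QP N :: (int ^ 'd) set)))"
    by (intro of_nat_mono) auto
  moreover have "real (card L) \<le> real N ^ ?d"
    using card_large_multiples[OF d, of K N] by (simp add: L_def K_def power_mult_distrib)
  moreover have "real (card (Q N :: (int ^ 'd) set)) \<ge> 2 * real N ^ ?d + 1"
  proof -
    have "2 * N ^ ?d \<le> 2 ^ ?d * N ^ ?d" using d power_increasing[of 1 ?d "2::nat"] by simp
    also have "\<dots> < (2 * N + 1) ^ ?d"
      using d by (simp only: power_mult_distrib[symmetric]) (rule power_strict_mono, auto)
    finally have "2 * N ^ ?d + 1 \<le> card (Q N :: (int ^ 'd) set)" by (simp add: card_Q)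
    hence "real (2 * N ^ ?d + 1) \<le> real (card (Q N :: (int ^ 'd) set))" by (rule of_nat_mono)
    thus ?thesis by simp
  qed
  ultimately have 1: "real N ^ ?d \<le> real (K * card (QP N :: (int ^ 'd) set))"
    unfolding of_nat_Suc of_nat_add by linarith
  have "real (card (Q N :: (int ^ 'd) set)) \<le> (3 * real N) ^ ?d"
    unfolding card_Q of_nat_power using N by (intro power_mono) auto
  also have "\<dots> \<le> 3 ^ ?d * real (K * card (QP N :: (int ^ 'd) set))"
    using 1 by (simp add: power_mult_distrib)
  also have "\<dots> = real (9 ^ ?d * card (QP N :: (int ^ 'd) set))"
    by (simp add: K_def power_mult_distrib[symmetric] flip: mult.assoc)
  finally show ?thesis by (simp only: of_nat_le_iff)
qed

lemma card_QP_pos: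
  assumes "CARD('d) \<ge> 2" "N > 0"
  shows "card (QP N :: (int ^ 'd) set) > 0"
  using card_Q_le_card_QP[OF assms] card_Q_pos[of N, where 'd = 'd] by (intro gr0I) auto

lemma card_Q_shift_ratio:
  "(\<lambda>N. real (card (Q (N + L) :: (int ^ 'd) set)) / real (card (Q N :: (int ^ 'd) set))) \<longlonglongrightarrow> 1"
proof -
  have "((\<lambda>n. 1 / real (Suc n)) \<circ> (\<lambda>N. 2 * N)) \<longlonglongrightarrow> 0"
    by (intro LIMSEQ_subseq_LIMSEQ LIMSEQ_Suc[OF lim_1_over_n])
       (simp add: strict_mono_def)
  hence "(\<lambda>N. (1 + 2 * real L * (1 / real (Suc (2 * N)))) ^ CARD('d)) \<longlonglongrightarrow> (1 + 2 * real L * 0) ^ CARD('d)"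
    by (intro tendsto_intros) (simp add: comp_def)
  moreover have "1 + 2 * real L * (1 / real (Suc (2 * N))) = real (2 * (N + L) + 1) / real (2 * N + 1)" for N
    by (simp add: field_simps)
  ultimately have "(\<lambda>N. (real (2 * (N + L) + 1) / real (2 * N + 1)) ^ CARD('d)) \<longlonglongrightarrow> 1" by simp
  thus ?thesis by (simp only: card_Q of_nat_power power_divide)
qed

section \<open>Ergodic averages with periodic weights\<close>

definition subgroup_Zd :: "(int ^ 'd) set \<Rightarrow> bool" where
  "subgroup_Zd H \<longleftrightarrow> 0 \<in> H \<and> (\<forall>u\<in>H. \<forall>v\<in>H. u + v \<in> H) \<and> (\<forall>v\<in>H. - v \<in> H)"

definition orbit_sum ::
    "(int ^ 'd \<Rightarrow> 'a \<Rightarrow> 'a) \<Rightarrow> (int ^ 'd) set \<Rightarrow> ('a \<Rightarrow> complex) \<Rightarrow> 'a \<Rightarrow> complex" where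
  "orbit_sum T S f x = (\<Sum>v\<in>S. translate T v f x)"

lemma countable_Zd: "countable (S :: (int ^ 'd) set)"
  using countable_vector[of "\<lambda>_ :: 'd. UNIV :: int set"] countable_subset by auto

context pp_action
begin

lemma integral_T:
  fixes f :: "'a \<Rightarrow> 'c :: {banach, second_countable_topology}"
  assumes [measurable]: "f \<in> borel_measurable M"
  shows "(\<integral>x. f (T v x) \<partial>M) = (\<integral>x. f x \<partial>M)"
  using integral_distr[OF measurable_T[of v] assms] distr_T[of v] by simp

lemma translate_L2:
  assumes "f \<in> L2 M"
  shows "translate T v f \<in> L2 M"
proof -
  note [measurable] = L2_measurable[OF assms]
  have "integrable (distr M M (T (- v))) (\<lambda>x. (norm (f x))\<^sup>2)"
    using L2_integrable_sq[OF assms] by (simp add: distr_T)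
  hence "integrable M (\<lambda>x. (norm (f (T (- v) x)))\<^sup>2)"
    by (rule integrable_distr[OF measurable_T])
  thus ?thesis by (simp add: L2_def translate_def)
qed

lemma L2_norm_translate:
  assumes "f \<in> L2 M"
  shows "L2_norm M (translate T v f) = L2_norm M f"
proof -
  have "(\<lambda>x. (norm (f x))\<^sup>2) \<in> borel_measurable M" using L2_measurable[OF assms] by measurable
  thus ?thesis using integral_T[of "\<lambda>x. (norm (f x))\<^sup>2" "- v"] by (simp add: L2_norm_def translate_def)
qed

lemma integral_translate:
  "f \<in> L2 M \<Longrightarrow> (\<integral>x. translate T v f x \<partial>M) = (\<integral>x. f x \<partial>M)"
  using integral_T[OF L2_measurable, of f "- v"] by (simp add: translate_def)

lemma translate_translate:
  "x \<in> space M \<Longrightarrow> translate T v (translate T u f) x = translate T (v + u) f x"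
  using T_add[of x "- u" "- v"] by (simp add: translate_def algebra_simps)

lemma orbit_sum_L2: "f \<in> L2 M \<Longrightarrow> orbit_sum T S f \<in> L2 M"
  unfolding orbit_sum_def[abs_def] by (intro L2_sum translate_L2)

lemma orbit_sum_add: "orbit_sum T S (\<lambda>x. f x + g x) = (\<lambda>x. orbit_sum T S f x + orbit_sum T S g x)"
  by (simp add: orbit_sum_def translate_def sum.distrib fun_eq_iff)

lemma orbit_sum_cmult: "orbit_sum T S (\<lambda>x. c * f x) = (\<lambda>x. c * orbit_sum T S f x)"
  by (simp add: orbit_sum_def translate_def sum_distrib_left fun_eq_iff)

lemma L2_norm_orbit_sum:
  assumes "f \<in> L2 M"
  shows "L2_norm M (orbit_sum T S f) \<le> real (card S) * L2_norm M f"
  using L2_norm_sum[of S "\<lambda>v. translate T v f" M] assms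
  by (simp add: orbit_sum_def[abs_def] translate_L2 L2_norm_translate)

text \<open>
  Ergodicity speaks of strictly invariant sets. As \<open>H\<close> is countable, the points all of whose
  \<open>H\<close>-translates lie in \<open>h -` B\<close> form such a set, which differs from \<open>h -` B\<close> by a null set.
\<close>

lemma ergodic_zero_one:
  fixes h :: "'a \<Rightarrow> real"
  assumes H: "subgroup_Zd H" and erg: "acts_ergodically M T H"
    and [measurable]: "h \<in> borel_measurable M" "B \<in> sets borel"
    and inv: "\<And>u. u \<in> H \<Longrightarrow> AE x in M. h (T u x) = h x"
  shows "(AE x in M. h x \<in> B) \<or> (AE x in M. h x \<notin> B)"
proof -
  define A where "A = {x \<in> space M. \<forall>u\<in>H. h (T u x) \<in> B}"
  have A: "A \<in> sets M"
    unfolding A_def by (rule sets.sets_Collect_countable_All'[OF _ countable_Zd]) measurable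
  have sub: "T v x \<in> A" if "v \<in> H" "x \<in> A" for v x
    using that H T_add[of x _ v] by (auto simp: A_def T_in_space subgroup_Zd_def)
       (metis (no_types, lifting))
  have "T v ` A = A" if "v \<in> H" for v
  proof
    show "A \<subseteq> T v ` A"
    proof
      fix x assume "x \<in> A"
      moreover have "- v \<in> H" using H that by (simp add: subgroup_Zd_def)
      ultimately have "T (- v) x \<in> A" by (intro sub)
      moreover have "x = T v (T (- v) x)" using \<open>x \<in> A\<close> by (simp add: A_def T_minus)
      ultimately show "x \<in> T v ` A" by blast
    qed
  qed (use sub that in auto)
  hence "prob A = 0 \<or> prob A = 1" using erg A by (simp add: acts_ergodically_def)
  moreover have "AE x in M. \<forall>u\<in>H. h (T u x) = h x"
    using inv by (simp add: AE_ball_countable countable_Zd)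
  hence "AE x in M. x \<in> A \<longleftrightarrow> h x \<in> B"
    by (rule AE_mp, intro AE_I2) (use H in \<open>auto simp: A_def subgroup_Zd_def\<close>)
  ultimately show ?thesis
    unfolding prob_eq_0[OF A] prob_eq_1[OF A]
  proof (elim disjE)
    assume "AE x in M. x \<in> A \<longleftrightarrow> h x \<in> B" "AE x in M. x \<notin> A"
    hence "AE x in M. h x \<notin> B" by eventually_elim simp
    thus ?thesis ..
  next
    assume "AE x in M. x \<in> A \<longleftrightarrow> h x \<in> B" "AE x in M. x \<in> A"
    hence "AE x in M. h x \<in> B" by eventually_elim simp
    thus ?thesis ..
  qed
qed

text \<open>
  An integrable function cannot exceed its mean almost everywhere, nor stay below it.
\<close>

lemma ergodic_constant_real:
  fixes h :: "'a \<Rightarrow> real"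
  assumes H: "subgroup_Zd H" and erg: "acts_ergodically M T H" and int: "integrable M h"
    and inv: "\<And>u. u \<in> H \<Longrightarrow> AE x in M. h (T u x) = h x"
  shows "AE x in M. h x = expectation h"
proof -
  have [measurable]: "h \<in> borel_measurable M" using int by simp
  have zero_one: "(AE x in M. h x \<in> B) \<or> (AE x in M. h x \<notin> B)" if "B \<in> sets borel" for B
    using H erg \<open>h \<in> borel_measurable M\<close> that inv by (rule ergodic_zero_one)
  have "AE x in M. h x \<notin> {expectation h<..}"
    using zero_one[OF borel_open[OF open_greaterThan], of "expectation h"]
      expectation_greater[OF int, of "expectation h"]
    unfolding greaterThan_iff less_irrefl by blast
  moreover have "AE x in M. h x \<notin> {..<expectation h}"
    using zero_one[OF borel_open[OF open_lessThan], of "expectation h"]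
      expectation_less[OF int, of "expectation h"]
    unfolding lessThan_iff less_irrefl by blast
  ultimately show ?thesis by eventually_elim simp
qed

lemma ergodic_constant:
  assumes H: "subgroup_Zd H" and erg: "acts_ergodically M T H" and f: "f \<in> L2 M"
    and inv: "\<And>u. u \<in> H \<Longrightarrow> AE x in M. translate T u f x = f x"
  shows "AE x in M. f x = (\<integral>x. f x \<partial>M)"
proof -
  have "AE x in M. f (T u x) = f x" if "u \<in> H" for u
    using inv[of "- u"] H that by (simp add: translate_def subgroup_Zd_def)
  hence "AE x in M. Re (f (T u x)) = Re (f x)" "AE x in M. Im (f (T u x)) = Im (f x)" if "u \<in> H" for u
    using that by (force elim: AE_mp)+
  note inv_parts = this and int = L2_integrable(1)[OF f]
  have "AE x in M. Re (f x) = (\<integral>x. Re (f x) \<partial>M)"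
    using inv_parts(1) int by (intro ergodic_constant_real[OF H erg]) auto
  moreover have "AE x in M. Im (f x) = (\<integral>x. Im (f x) \<partial>M)"
    using inv_parts(2) int by (intro ergodic_constant_real[OF H erg]) auto
  ultimately show ?thesis by eventually_elim (simp add: complex_eq_iff int)
qed

text \<open>
  Subtracting the sum for \<open>translate T u f\<close> cancels all terms except those near the boundary of the
  cube, because \<open>D\<close> is \<open>u\<close>-periodic; the boundary is negligible compared with the cube.
\<close>

lemma orbit_sum_coboundary:
  assumes D: "\<And>v. v + u \<in> D \<longleftrightarrow> v \<in> D" and f: "f \<in> L2 M"
  shows "(\<lambda>N. L2_norm M (orbit_sum T (Q N \<inter> D) (\<lambda>x. f x - translate T u f x)) /
    real (card (Q N :: (int ^ 'd) set))) \<longlonglongrightarrow> 0"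
proof -
  define L where "L = Max (range (\<lambda>i. nat \<bar>u $ i\<bar>))"
  have u: "u \<in> Q L"
  proof -
    have "nat \<bar>u $ i\<bar> \<le> L" for i unfolding L_def by (rule Max_ge) auto
    thus ?thesis by (simp add: Q_def nat_le_iff)
  qed
  define r where "r N = real (card (Q (N + L) :: (int ^ 'd) set)) / real (card (Q N :: (int ^ 'd) set))" for N
  have "L2_norm M (orbit_sum T (Q N \<inter> D) (\<lambda>x. f x - translate T u f x)) / real (card (Q N :: (int ^ 'd) set))
    \<le> 2 * (r N - 1) * L2_norm M f" for N
  proof -
    define S where "S = Q N \<inter> D"
    define S' where "S' = (\<lambda>v. v + u) ` S"
    have fin: "finite S" "finite S'" by (simp_all add: S_def S'_def)
    have "card S' = card S" unfolding S'_def by (rule card_image) simp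
    hence card_eq: "card (S - S') = card (S' - S)"
      using fin card_Int_Diff[of S S'] card_Int_Diff[of S' S] by (simp add: Int_commute)
    have "S' - S \<subseteq> Q (N + L) - Q N"
    proof
      fix w assume w: "w \<in> S' - S"
      then obtain v where v: "v \<in> S" "w = v + u" by (auto simp: S'_def)
      have "\<bar>v $ i + u $ i\<bar> \<le> int N + int L" for i
        using v(1) u abs_triangle_ineq[of "v $ i" "u $ i"] unfolding S_def Q_def
        by (smt (verit) IntD1 mem_Collect_eq)
      hence "w \<in> Q (N + L)" using v by (simp add: Q_def)
      thus "w \<in> Q (N + L) - Q N" using w v D[of v] by (auto simp: S_def)
    qed
    hence "card (S' - S) \<le> card (Q (N + L) - Q N :: (int ^ 'd) set)" by (intro card_mono) auto
    hence card_le: "real (card (S' - S)) \<le> real (card (Q (N + L) :: (int ^ 'd) set)) - real (card (Q N :: (int ^ 'd) set))"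
      using card_Diff_subset[of "Q N :: (int ^ 'd) set" "Q (N + L)"] Q_mono[of N "N + L", where 'd = 'd]
        card_mono[of "Q (N + L) :: (int ^ 'd) set" "Q N"] by simp
    have "orbit_sum T S (\<lambda>x. f x - translate T u f x) x
        = orbit_sum T (S - S') f x - orbit_sum T (S' - S) f x" if x: "x \<in> space M" for x
    proof -
      have "orbit_sum T S (\<lambda>x. f x - translate T u f x) x
          = (\<Sum>v\<in>S. translate T v f x) - (\<Sum>v\<in>S. translate T v (translate T u f) x)"
        by (simp add: orbit_sum_def translate_def sum_subtractf)
      also have "(\<Sum>v\<in>S. translate T v (translate T u f) x) = (\<Sum>v\<in>S'. translate T v f x)"
        unfolding S'_def using x by (subst sum.reindex) (simp_all add: translate_translate)
      also have "(\<Sum>v\<in>S. translate T v f x) - (\<Sum>v\<in>S'. translate T v f x)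
          = (\<Sum>v\<in>S - S'. translate T v f x) - (\<Sum>v\<in>S' - S. translate T v f x)"
        using sum.Int_Diff[OF fin(1), of "\<lambda>v. translate T v f x" S']
          sum.Int_Diff[OF fin(2), of "\<lambda>v. translate T v f x" S]
        by (simp add: Int_commute)
      finally show ?thesis by (simp add: orbit_sum_def)
    qed
    hence "L2_norm M (orbit_sum T S (\<lambda>x. f x - translate T u f x))
        = L2_norm M (\<lambda>x. orbit_sum T (S - S') f x - orbit_sum T (S' - S) f x)"
      by (rule L2_norm_cong)
    also have "\<dots> \<le> L2_norm M (orbit_sum T (S - S') f) + L2_norm M (orbit_sum T (S' - S) f)"
      by (intro L2_norm_diff orbit_sum_L2 f)
    also have "\<dots> \<le> real (card (S - S')) * L2_norm M f + real (card (S' - S)) * L2_norm M f"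
      by (intro add_mono L2_norm_orbit_sum f)
    also have "\<dots> = 2 * real (card (S' - S)) * L2_norm M f" by (simp add: card_eq)
    also have "\<dots> \<le> 2 * (real (card (Q (N + L) :: (int ^ 'd) set)) - real (card (Q N :: (int ^ 'd) set))) * L2_norm M f"
      using card_le by (intro mult_right_mono) auto
    finally show ?thesis
      using card_Q_pos[of N, where 'd = 'd] by (simp add: S_def r_def field_simps)
  qed
  note bound = this
  have "(\<lambda>N. 2 * (r N - 1) * L2_norm M f) \<longlonglongrightarrow> 2 * (1 - 1) * L2_norm M f"
    unfolding r_def by (intro tendsto_intros card_Q_shift_ratio)
  hence "(\<lambda>N. 2 * (r N - 1) * L2_norm M f) \<longlonglongrightarrow> 0" by simp
  thus ?thesis
  proof (rule tendsto_sandwich[OF always_eventually always_eventually tendsto_const, rotated 2])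
    show "\<forall>N. L2_norm M (orbit_sum T (Q N \<inter> D) (\<lambda>x. f x - translate T u f x)) /
        real (card (Q N :: (int ^ 'd) set)) \<le> 2 * (r N - 1) * L2_norm M f"
      using bound by blast
  qed simp
qed

text \<open>
  The functions \<open>F\<close> of mean zero whose averages are asymptotically those of \<open>f\<close> form a closed convex
  set, invariant under the isometries induced by \<open>H\<close> because \<open>F\<close> and its translates have the same
  averages up to a boundary term. By uniqueness, its element of minimal norm is \<open>H\<close>-invariant, hence
  constant by ergodicity, hence zero: the averages of \<open>f\<close> are asymptotically those of \<open>0\<close>.
\<close>

lemma periodic_mean_ergodic:
  assumes H: "subgroup_Zd H" and erg: "acts_ergodically M T H"
    and D: "\<And>u v. u \<in> H \<Longrightarrow> v + u \<in> D \<longleftrightarrow> v \<in> D"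
    and f: "f \<in> L2 M" and mean: "(\<integral>x. f x \<partial>M) = 0"
  shows "(\<lambda>N. L2_norm M (orbit_sum T (Q N \<inter> D) f) / real (card (Q N :: (int ^ 'd) set))) \<longlonglongrightarrow> 0"
proof -
  define B where "B N F = L2_norm M (orbit_sum T (Q N \<inter> D) F) / real (card (Q N :: (int ^ 'd) set))" for N F
  have B_nonneg: "B N F \<ge> 0" for N F by (simp add: B_def)
  have B_add: "B N (\<lambda>x. F x + G x) \<le> B N F + B N G" if "F \<in> L2 M" "G \<in> L2 M" for N F G
    using L2_norm_add[OF orbit_sum_L2[OF that(1)] orbit_sum_L2[OF that(2)]]
    by (simp add: B_def orbit_sum_add divide_right_mono flip: add_divide_distrib)
  have B_cmult: "B N (\<lambda>x. c * F x) = norm c * B N F" for N c F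
    by (simp add: B_def orbit_sum_cmult L2_norm_cmult)
  have B_le: "B N F \<le> L2_norm M F" if "F \<in> L2 M" for N F
  proof -
    have "card (Q N \<inter> D) \<le> card (Q N :: (int ^ 'd) set)" by (intro card_mono) auto
    hence "real (card (Q N \<inter> D)) * L2_norm M F \<le> real (card (Q N :: (int ^ 'd) set)) * L2_norm M F"
      by (intro mult_right_mono) auto
    with L2_norm_orbit_sum[OF that, of "Q N \<inter> D"]
    have "L2_norm M (orbit_sum T (Q N \<inter> D) F) \<le> real (card (Q N :: (int ^ 'd) set)) * L2_norm M F"
      by linarith
    thus ?thesis using card_Q_pos[of N, where 'd = 'd] by (simp add: B_def field_simps)
  qed
  have B_limI: "(\<lambda>N. B N F) \<longlonglongrightarrow> 0"
    if "\<And>N. B N F \<le> b N" "b \<longlonglongrightarrow> 0" for F b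
    by (rule tendsto_sandwich[OF always_eventually always_eventually tendsto_const that(2)])
       (use B_nonneg that in auto)
  define C where "C = {F \<in> L2 M. (\<integral>x. F x \<partial>M) = 0 \<and> (\<lambda>N. B N (\<lambda>x. f x - F x)) \<longlonglongrightarrow> 0}"
  have C_L2: "C \<subseteq> L2 M" by (auto simp: C_def)
  have "f \<in> C"
  proof -
    have "B N (\<lambda>x. f x - f x) = 0" for N using B_cmult[of N 0] by simp
    thus ?thesis using f mean by (simp add: C_def)
  qed
  hence "C \<noteq> {}" by auto
  have mid: "(\<lambda>x. (F x + G x) / 2) \<in> C" if FG: "F \<in> C" "G \<in> C" for F G
  proof -
    have L2: "F \<in> L2 M" "G \<in> L2 M" using FG C_L2 by auto
    have "(\<lambda>x. (F x + G x) / 2) \<in> L2 M" using L2_cmult[OF L2_add[OF L2], of "1/2"] by simp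
    moreover have "(\<integral>x. (F x + G x) / 2 \<partial>M) = 0"
      using FG L2_integrable(1)[OF L2(1)] L2_integrable(1)[OF L2(2)] by (simp add: C_def)
    moreover have "(\<lambda>N. B N (\<lambda>x. f x - (F x + G x) / 2)) \<longlonglongrightarrow> 0"
    proof (rule B_limI)
      have eq: "(\<lambda>x. f x - (F x + G x) / 2) = (\<lambda>x. (1/2) * (f x - F x) + (1/2) * (f x - G x))"
        by (simp add: fun_eq_iff field_simps)
      show "B N (\<lambda>x. f x - (F x + G x) / 2) \<le> B N (\<lambda>x. f x - F x) / 2 + B N (\<lambda>x. f x - G x) / 2" for N
        unfolding eq
        using B_add[OF L2_cmult[OF L2_diff[OF f L2(1)]] L2_cmult[OF L2_diff[OF f L2(2)]], of N "1/2" "1/2"]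
        by (simp only: B_cmult) simp
      have "(\<lambda>N. B N (\<lambda>x. f x - F x) / 2 + B N (\<lambda>x. f x - G x) / 2) \<longlonglongrightarrow> 0 / 2 + 0 / 2"
        using FG unfolding C_def by (intro tendsto_intros) auto
      thus "(\<lambda>N. B N (\<lambda>x. f x - F x) / 2 + B N (\<lambda>x. f x - G x) / 2) \<longlonglongrightarrow> 0" by simp
    qed
    ultimately show ?thesis by (simp add: C_def)
  qed
  have closed: "g \<in> C"
    if F: "\<And>n. F n \<in> C" and g: "g \<in> L2 M" and lim: "(\<lambda>n. L2_norm M (\<lambda>x. F n x - g x)) \<longlonglongrightarrow> 0" for F g
  proof -
    have FL2: "F n \<in> L2 M" for n using F C_L2 by auto
    have "norm (\<integral>x. g x \<partial>M) \<le> L2_norm M (\<lambda>x. F n x - g x)" for n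
    proof -
      have "(\<integral>x. F n x - g x \<partial>M) = - (\<integral>x. g x \<partial>M)"
        using F[of n] L2_integrable(1)[OF FL2[of n]] L2_integrable(1)[OF g] by (simp add: C_def)
      thus ?thesis using L2_integrable(3)[OF L2_diff[OF FL2[of n] g]] by simp
    qed
    hence "norm (\<integral>x. g x \<partial>M) \<le> 0" by (intro LIMSEQ_le_const[OF lim]) auto
    moreover have "(\<lambda>N. B N (\<lambda>x. f x - g x)) \<longlonglongrightarrow> 0"
    proof (rule LIMSEQ_I)
      fix e :: real assume "e > 0"
      then obtain n where n: "L2_norm M (\<lambda>x. F n x - g x) < e / 2"
        using LIMSEQ_D[OF lim, of "e / 2"] by auto
      have "(\<lambda>N. B N (\<lambda>x. f x - F n x)) \<longlonglongrightarrow> 0" using F[of n] by (simp add: C_def)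
      then obtain N0 where N0: "\<And>N. N \<ge> N0 \<Longrightarrow> norm (B N (\<lambda>x. f x - F n x) - 0) < e / 2"
        using LIMSEQ_D[of _ 0 "e / 2"] half_gt_zero[OF \<open>e > 0\<close>] by blast
      have "norm (B N (\<lambda>x. f x - g x) - 0) < e" if "N \<ge> N0" for N
      proof -
        have "B N (\<lambda>x. f x - g x) \<le> B N (\<lambda>x. f x - F n x) + B N (\<lambda>x. F n x - g x)"
          using B_add[OF L2_diff[OF f FL2[of n]] L2_diff[OF FL2[of n] g], of N] by simp
        also have "\<dots> < e / 2 + e / 2"
          using N0[OF that] n B_le[OF L2_diff[OF FL2[of n] g], of N] by simp
        finally show ?thesis using B_nonneg by simp
      qed
      thus "\<exists>N0. \<forall>N\<ge>N0. norm (B N (\<lambda>x. f x - g x) - 0) < e" by blast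
    qed
    ultimately show ?thesis using g by (simp add: C_def)
  qed
  have translate_C: "translate T u F \<in> C" if u: "u \<in> H" and F: "F \<in> C" for u F
  proof -
    have FL2: "F \<in> L2 M" using F C_L2 by auto
    have "(\<lambda>N. B N (\<lambda>x. f x - translate T u F x)) \<longlonglongrightarrow> 0"
    proof (rule B_limI)
      show "B N (\<lambda>x. f x - translate T u F x)
          \<le> B N (\<lambda>x. f x - F x) + B N (\<lambda>x. F x - translate T u F x)" for N
        using B_add[OF L2_diff[OF f FL2] L2_diff[OF FL2 translate_L2[OF FL2]], of N u] by simp
      have "(\<lambda>N. B N (\<lambda>x. f x - F x) + B N (\<lambda>x. F x - translate T u F x)) \<longlonglongrightarrow> 0 + 0"
        using F orbit_sum_coboundary[OF D[OF u] FL2] unfolding C_def B_def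
        by (intro tendsto_add) auto
      thus "(\<lambda>N. B N (\<lambda>x. f x - F x) + B N (\<lambda>x. F x - translate T u F x)) \<longlonglongrightarrow> 0" by simp
    qed
    thus ?thesis using F FL2 by (simp add: C_def translate_L2 integral_translate)
  qed
  obtain g where g: "g \<in> C"
    and unique: "\<And>h. h \<in> C \<Longrightarrow> L2_norm M h = L2_norm M g \<Longrightarrow> L2_norm M (\<lambda>x. h x - g x) = 0"
  proof (rule L2_minimal_norm[OF C_L2 \<open>C \<noteq> {}\<close>])
    fix F G assume "F \<in> C" "G \<in> C"
    thus "(\<lambda>x. (F x + G x) / 2) \<in> C" by (rule mid)
  next
    fix F g assume "\<And>n. F n \<in> C" "g \<in> L2 M" "(\<lambda>n. L2_norm M (\<lambda>x. F n x - g x)) \<longlonglongrightarrow> 0"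
    thus "g \<in> C" by (rule closed)
  qed (use that in blast)
  have gL2: "g \<in> L2 M" using g C_L2 by auto
  have "AE x in M. translate T u g x = g x" if "u \<in> H" for u
    using L2_norm_eq_0_AE[OF L2_diff[OF translate_L2[OF gL2] gL2]
        unique[OF translate_C[OF that g] L2_norm_translate[OF gL2]]] by simp
  hence "AE x in M. g x = (\<integral>x. g x \<partial>M)" by (rule ergodic_constant[OF H erg gL2])
  hence "AE x in M. g x = 0" using g by (simp add: C_def)
  hence "L2_norm M g = L2_norm M (\<lambda>_. 0)" by (intro L2_norm_cong_AE L2_measurable gL2 L2_zero) auto
  hence norm_g: "L2_norm M g = 0" by (simp add: L2_norm_def)
  have "(\<lambda>N. B N f) \<longlonglongrightarrow> 0"
  proof (rule B_limI)
    show "B N f \<le> B N (\<lambda>x. f x - g x)" for N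
      using B_add[OF L2_diff[OF f gL2] gL2, of N] B_le[OF gL2, of N] norm_g by simp
    show "(\<lambda>N. B N (\<lambda>x. f x - g x)) \<longlonglongrightarrow> 0" using g by (simp add: C_def)
  qed
  thus ?thesis by (simp add: B_def)
qed

end

section \<open>Averages over primitive vectors\<close>

lemma subgroup_multiples: "subgroup_Zd (multiples k)"
  by (simp add: subgroup_Zd_def multiples_def)

lemma finite_index_multiples:
  assumes "k > 0"
  shows "finite_index_subgroup (multiples k :: (int ^ 'd) set)"
proof -
  have "range (\<lambda>v :: int ^ 'd. (+) v ` multiples k) \<subseteq> (\<lambda>v. (+) v ` multiples k) ` Q k"
  proof
    fix S assume "S \<in> range (\<lambda>v :: int ^ 'd. (+) v ` multiples k)"
    then obtain v :: "int ^ 'd" where S: "S = (+) v ` multiples k" by auto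
    define r :: "int ^ 'd" where "r = (\<chi> i. v $ i mod int k)"
    have "r \<in> Q k" using assms by (simp add: Q_def r_def less_imp_le)
    have same: "x - v \<in> multiples k \<longleftrightarrow> x - r \<in> multiples k" for x
      unfolding multiples_def r_def
      by (simp add: mod_eq_dvd_iff[symmetric] mod_diff_right_eq)
    have coset: "(+) a ` multiples k = {x. x - a \<in> multiples k}" for a :: "int ^ 'd"
      by (auto simp: image_iff) (metis diff_add_cancel add.commute)
    have "S = (+) r ` multiples k" unfolding S coset same ..
    with \<open>r \<in> Q k\<close> show "S \<in> (\<lambda>v. (+) v ` multiples k) ` Q k" by blast
  qed
  hence "finite (range (\<lambda>v :: int ^ 'd. (+) v ` multiples k))"
    by (rule finite_subset) simp
  thus ?thesis
    using subgroup_multiples[of k, where 'a = 'd] by (simp add: finite_index_subgroup_def subgroup_Zd_def)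
qed

text \<open>
  The vectors that survive the sieve by all factors up to \<open>K\<close>: a periodic set that approximates the
  primitive vectors from above.
\<close>

definition sifted :: "nat \<Rightarrow> (int ^ 'd) set" where
  "sifted K = {v. \<forall>k\<in>{2..K}. v \<notin> multiples k}"

lemma sifted_periodic:
  assumes "u \<in> multiples (fact K)"
  shows "v + u \<in> sifted K \<longleftrightarrow> v \<in> sifted K"
proof -
  have "v + u \<in> multiples k \<longleftrightarrow> v \<in> multiples k" if "k \<in> {2..K}" for k
  proof -
    have "k dvd fact K" using that by (intro dvd_fact) auto
    hence "int k dvd int (fact K)" by (simp only: int_dvd_int_iff)
    hence "int k dvd u $ i" for i using assms by (auto simp: multiples_def intro: dvd_trans)
    thus ?thesis by (simp add: multiples_def dvd_add_left_iff)
  qed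
  thus ?thesis by (auto simp: sifted_def)
qed

lemma QP_subset_sifted: "(QP N :: (int ^ 'd) set) \<subseteq> Q N \<inter> sifted K"
proof
  fix v :: "int ^ 'd" assume "v \<in> QP N"
  hence v: "v \<in> Q N" "\<And>k. v \<in> multiples k \<Longrightarrow> k = 1" by (auto simp: QP_def primitive_iff)
  have "v \<notin> multiples k" if "k \<in> {2..K}" for k using v(2)[of k] that by auto
  thus "v \<in> Q N \<inter> sifted K" using v(1) by (simp add: sifted_def)
qed

lemma sifted_not_primitive:
  assumes "v \<in> sifted K" "v \<notin> primitive_vectors" "K \<ge> 2"
  shows "v \<noteq> 0 \<and> (\<exists>k>K. v \<in> multiples k)"
proof -
  have "v \<noteq> 0"
  proof
    assume "v = 0"
    hence "v \<in> multiples 2" by (simp add: multiples_def)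
    thus False using assms by (auto simp: sifted_def)
  qed
  moreover from this obtain k where k: "v \<in> multiples k" "k \<noteq> 1"
    using assms(2) by (auto simp: primitive_iff)
  moreover have "k \<noteq> 0"
    using k \<open>v \<noteq> 0\<close> by (auto simp: multiples_def vec_eq_iff intro: ccontr)
  ultimately have "k > K" using assms(1) by (cases "k \<le> K") (auto simp: sifted_def)
  thus ?thesis using k \<open>v \<noteq> 0\<close> by blast
qed

context pp_action
begin

text \<open>
  The vectors of the cube that survive the sieve but are not primitive are multiples of some
  \<open>k > K\<close>, so they are at most a fraction \<open>3 ^ d / K\<close> of the cube. The factor \<open>9 ^ d\<close> is the cost of
  normalising by \<open>QP N\<close> instead of \<open>Q N\<close>.
\<close>

lemma L2_norm_orbit_sum_QP:
  assumes d: "CARD('d) \<ge> 2" and K: "K \<ge> 2" and N: "N > 0" and f: "f \<in> L2 M"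
  shows "L2_norm M (orbit_sum T (QP N) f) / real (card (QP N :: (int ^ 'd) set))
    \<le> 9 ^ CARD('d) * (L2_norm M (orbit_sum T (Q N \<inter> sifted K) f) / real (card (Q N :: (int ^ 'd) set)))
       + 27 ^ CARD('d) * L2_norm M f / real K"
proof -
  let ?d = "CARD('d)"
  define q p where "q = real (card (Q N :: (int ^ 'd) set))" and "p = real (card (QP N :: (int ^ 'd) set))"
  define R where "R = Q N \<inter> sifted K - (QP N :: (int ^ 'd) set)"
  define S where "S = L2_norm M (orbit_sum T (Q N \<inter> sifted K) f)"
  have q: "q > 0" using card_Q_pos[of N, where 'd = 'd] by (simp add: q_def)
  have "q \<le> real (9 ^ ?d * card (QP N :: (int ^ 'd) set))"
    unfolding q_def using card_Q_le_card_QP[OF d N] by (rule of_nat_mono)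
  hence qp: "q \<le> 9 ^ ?d * p" by (simp add: p_def)
  with q have "0 < 9 ^ ?d * p" by linarith
  hence p: "p > 0" by (simp add: zero_less_mult_iff)
  have "R \<subseteq> {v \<in> Q N. v \<noteq> 0 \<and> (\<exists>k>K. v \<in> multiples k)}"
    using sifted_not_primitive[OF _ _ K] by (auto simp: R_def QP_def)
  hence "real (card R) \<le> real (card {v \<in> Q N :: (int ^ 'd) set. v \<noteq> 0 \<and> (\<exists>k>K. v \<in> multiples k)})"
    by (intro of_nat_mono card_mono) auto
  also have "\<dots> \<le> (3 * real N) ^ ?d / real K" using K by (intro card_large_multiples d) auto
  also have "\<dots> \<le> 3 ^ ?d * q / real K"
  proof -
    have "real N ^ ?d \<le> (2 * real N + 1) ^ ?d" by (intro power_mono) auto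
    also have "\<dots> = q" by (simp add: q_def card_Q add.commute)
    finally show ?thesis by (simp add: power_mult_distrib divide_right_mono)
  qed
  finally have R: "real (card R) \<le> 3 ^ ?d * q / real K" .
  have "orbit_sum T (QP N) f x = orbit_sum T (Q N \<inter> sifted K) f x - orbit_sum T R f x" for x
    using sum.subset_diff[OF QP_subset_sifted[of N K], of "\<lambda>v. translate T v f x"]
    by (simp add: orbit_sum_def R_def)
  hence "L2_norm M (orbit_sum T (QP N) f)
      = L2_norm M (\<lambda>x. orbit_sum T (Q N \<inter> sifted K) f x - orbit_sum T R f x)" by presburger
  also have "\<dots> \<le> S + L2_norm M (orbit_sum T R f)"
    unfolding S_def by (intro L2_norm_diff orbit_sum_L2 f)
  also have "\<dots> \<le> S + real (card R) * L2_norm M f"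
    by (intro add_left_mono L2_norm_orbit_sum f)
  also have "\<dots> \<le> S + 3 ^ ?d * q / real K * L2_norm M f"
    by (intro add_left_mono mult_right_mono R) simp
  finally have "L2_norm M (orbit_sum T (QP N) f) / p \<le> (S + 3 ^ ?d * q / real K * L2_norm M f) / p"
    using p by (intro divide_right_mono) auto
  also have "\<dots> \<le> (S + 3 ^ ?d * q / real K * L2_norm M f) * (9 ^ ?d / q)"
  proof -
    have "1 / p \<le> 9 ^ ?d / q" using qp p q by (simp add: field_simps)
    moreover have "0 \<le> S + 3 ^ ?d * q / real K * L2_norm M f" using q by (simp add: S_def)
    ultimately show ?thesis using mult_left_mono by fastforce
  qed
  also have "\<dots> = 9 ^ ?d * (S / q) + (3 ^ ?d * 9 ^ ?d) * L2_norm M f / real K"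
    using q by (simp add: field_simps)
  also have "(3::real) ^ ?d * 9 ^ ?d = 27 ^ ?d" by (simp flip: power_mult_distrib)
  finally show ?thesis by (simp add: p_def q_def S_def)
qed

text \<open>
  \<open>K\<close> is chosen to make the sieving error small uniformly in \<open>N\<close>; then \<open>N\<close> tends to infinity. For
  fixed \<open>K\<close> the sieve is periodic modulo \<open>fact K\<close>, and total ergodicity provides an ergodic period
  lattice.
\<close>

lemma primitive_mean_ergodic_zero:
  assumes d: "CARD('d) \<ge> 2" and erg: "totally_ergodic M T"
    and f: "f \<in> L2 M" and mean: "(\<integral>x. f x \<partial>M) = 0"
  shows "(\<lambda>N. L2_norm M (orbit_sum T (QP N) f) / real (card (QP N :: (int ^ 'd) set))) \<longlonglongrightarrow> 0"
proof (rule LIMSEQ_I)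
  let ?d = "CARD('d)"
  fix e :: real assume e: "e > 0"
  define K where "K = max 2 (nat \<lceil>2 * 27 ^ ?d * L2_norm M f / e\<rceil> + 1)"
  have K: "K \<ge> 2" by (simp add: K_def)
  have "2 * 27 ^ ?d * L2_norm M f / e < real K" unfolding K_def by linarith
  hence tail: "27 ^ ?d * L2_norm M f / real K < e / 2" using e K by (simp add: field_simps)
  have "acts_ergodically M T (multiples (fact K))"
    using erg finite_index_multiples[of "fact K", where 'd = 'd] by (simp add: totally_ergodic_def)
  from periodic_mean_ergodic[OF subgroup_multiples this sifted_periodic f mean]
  have "(\<lambda>N. L2_norm M (orbit_sum T (Q N \<inter> sifted K) f) / real (card (Q N :: (int ^ 'd) set))) \<longlonglongrightarrow> 0"
    by simp
  from LIMSEQ_D[OF tendsto_mult_right_zero[OF this, of "9 ^ ?d"], of "e / 2"] e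
  obtain N0 where N0: "\<And>N. N \<ge> N0 \<Longrightarrow>
      9 ^ ?d * (L2_norm M (orbit_sum T (Q N \<inter> sifted K) f) / real (card (Q N :: (int ^ 'd) set))) < e / 2"
    by (auto simp: abs_less_iff)
  have "norm (L2_norm M (orbit_sum T (QP N) f) / real (card (QP N :: (int ^ 'd) set)) - 0) < e"
    if N: "N \<ge> max 1 N0" for N
  proof -
    have "L2_norm M (orbit_sum T (QP N) f) / real (card (QP N :: (int ^ 'd) set)) < e"
      using L2_norm_orbit_sum_QP[OF d K _ f, of N] N0[of N] tail N by linarith
    thus ?thesis by simp
  qed
  thus "\<exists>N1. \<forall>N\<ge>N1. norm (L2_norm M (orbit_sum T (QP N) f) / real (card (QP N :: (int ^ 'd) set)) - 0) < e"
    by blast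
qed

lemma primitive_average_converges:
  assumes d: "CARD('d) \<ge> 2" and erg: "totally_ergodic M T" and f: "f \<in> L2 M"
  shows "L2_converges M (primitive_average T f) (\<lambda>_. \<integral>x. f x \<partial>M)"
proof -
  define c where "c = (\<integral>x. f x \<partial>M)"
  define g where "g x = f x - c" for x
  have g: "g \<in> L2 M" unfolding g_def using L2_diff[OF f L2_const] .
  have "(\<integral>x. g x \<partial>M) = 0"
    unfolding g_def using L2_integrable(1)[OF f] by (simp add: c_def prob_space)
  note lim = primitive_mean_ergodic_zero[OF d erg g this]
  have avg: "primitive_average T f N = (\<lambda>x. (1 / of_nat (card (QP N :: (int ^ 'd) set))) * orbit_sum T (QP N) f x)" for N
    by (simp add: primitive_average_def orbit_sum_def fun_eq_iff)
  have "L2_norm M (\<lambda>x. primitive_average T f N x - c)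
      = L2_norm M (orbit_sum T (QP N) g) / real (card (QP N :: (int ^ 'd) set))" if "N > 0" for N
  proof -
    have "card (QP N :: (int ^ 'd) set) > 0"
      by (rule card_QP_pos[OF d that])
    hence n: "of_nat (card (QP N :: (int ^ 'd) set)) \<noteq> (0 :: complex)"
      by (simp only: of_nat_eq_0_iff)
    have "orbit_sum T (QP N) g x = orbit_sum T (QP N) f x - of_nat (card (QP N :: (int ^ 'd) set)) * c" for x
      by (simp add: orbit_sum_def g_def translate_def sum_subtractf)
    hence "(\<lambda>x. primitive_average T f N x - c)
        = (\<lambda>x. (1 / of_nat (card (QP N :: (int ^ 'd) set))) * orbit_sum T (QP N) g x)"
      unfolding avg fun_eq_iff by (simp only: right_diff_distrib) (simp only: n divide_inverse
          mult_1_left mult.assoc[symmetric] left_inverse not_False_eq_True simp_thms)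
    thus ?thesis by (simp only: L2_norm_cmult) (simp add: norm_divide)
  qed
  hence "\<forall>\<^sub>F N in sequentially. L2_norm M (orbit_sum T (QP N) g) / real (card (QP N :: (int ^ 'd) set))
      = L2_norm M (\<lambda>x. primitive_average T f N x - c)"
    by (intro eventually_sequentiallyI[of 1]) simp
  with lim have "(\<lambda>N. L2_norm M (\<lambda>x. primitive_average T f N x - c)) \<longlonglongrightarrow> 0"
    by (rule Lim_transform_eventually)
  moreover have "primitive_average T f N \<in> L2 M" for N
    unfolding avg by (intro L2_cmult orbit_sum_L2 f)
  ultimately show ?thesis by (simp add: L2_converges_def L2_const c_def)
qed

section \<open>Recurrence along primitive vectors\<close>

lemma T_image_sets:
  assumes "A \<in> sets M"
  shows "T v ` A \<in> sets M" and "x \<in> space M \<Longrightarrow> x \<in> T v ` A \<longleftrightarrow> T (- v) x \<in> A"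
proof -
  have A: "A \<subseteq> space M" by (rule sets.sets_into_space[OF assms])
  show iff: "x \<in> T v ` A \<longleftrightarrow> T (- v) x \<in> A" if "x \<in> space M" for x
  proof
    assume "x \<in> T v ` A"
    then obtain y where y: "y \<in> A" "x = T v y" by auto
    hence "y \<in> space M" using A by auto
    thus "T (- v) x \<in> A" using y by (simp add: T_minus)
  next
    assume "T (- v) x \<in> A"
    thus "x \<in> T v ` A" using image_eqI[of x "T v" "T (- v) x" A] T_minus(2)[OF that, of v] by simp
  qed
  have "T v ` A = T (- v) -` A \<inter> space M"
  proof (intro set_eqI)
    fix x show "x \<in> T v ` A \<longleftrightarrow> x \<in> T (- v) -` A \<inter> space M"
      using iff[of x] A T_in_space[of _ v] by (cases "x \<in> space M") auto
  qed
  thus "T v ` A \<in> sets M" using measurable_sets[OF measurable_T assms] by simp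
qed

lemma integral_complex_indicator:
  assumes "A \<in> sets M"
  shows "integrable M (\<lambda>x. indicator A x :: complex)"
    and "(\<integral>x. (indicator A x :: complex) \<partial>M) = of_real (prob A)"
proof -
  have "has_bochner_integral M (\<lambda>x. of_real (indicator A x) :: complex) (of_real (prob A))"
    using assms by (intro has_bochner_integral_of_real has_bochner_integral_real_indicator)
       (auto simp: emeasure_eq_measure)
  moreover have "(\<lambda>x. of_real (indicator A x) :: complex) = indicator A"
    by (simp add: fun_eq_iff indicator_def)
  ultimately have "has_bochner_integral M (\<lambda>x. indicator A x :: complex) (of_real (prob A))" by simp
  thus "integrable M (\<lambda>x. indicator A x :: complex)"
    and "(\<integral>x. (indicator A x :: complex) \<partial>M) = of_real (prob A)"
    by (auto simp: has_bochner_integral_iff)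
qed

text \<open>
  Mean convergence for \<open>indicator A\<close>, paired with \<open>indicator A\<close>.
\<close>

lemma correlation_average:
  assumes d: "CARD('d) \<ge> 2" and erg: "totally_ergodic M T" and A: "A \<in> sets M"
  shows "(\<lambda>N. (\<Sum>v\<in>QP N. prob (A \<inter> T v ` A)) / real (card (QP N :: (int ^ 'd) set))) \<longlonglongrightarrow> (prob A)\<^sup>2"
proof -
  define f :: "'a \<Rightarrow> complex" where "f = indicator A"
  have [measurable]: "f \<in> borel_measurable M" unfolding f_def by (rule borel_measurable_indicator[OF A])
  have f: "f \<in> L2 M"
    by (rule L2_bound[OF L2_const[of 1] \<open>f \<in> borel_measurable M\<close>, where c = 1])
       (auto simp: f_def indicator_def)
  have int_f: "(\<integral>x. f x \<partial>M) = of_real (prob A)"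
    unfolding f_def by (rule integral_complex_indicator(2)[OF A])
  define h where "h N x = primitive_average T f N x - of_real (prob A)" for N x
  from primitive_average_converges[OF d erg f]
  have avg: "primitive_average T f N \<in> L2 M" and lim: "(\<lambda>N. L2_norm M (h N)) \<longlonglongrightarrow> 0" for N
    by (simp_all add: L2_converges_def int_f h_def[abs_def])
  have h: "h N \<in> L2 M" for N unfolding h_def[abs_def] by (intro L2_diff avg L2_const)
  have fh: "(\<lambda>x. f x * h N x) \<in> L2 M" for N
  proof (rule L2_bound[OF h[of N], where c = 1])
    note [measurable] = L2_measurable[OF h[of N]]
    show "(\<lambda>x. f x * h N x) \<in> borel_measurable M" by measurable
  qed (auto simp: f_def indicator_def norm_mult)
  have bound: "norm (\<integral>x. f x * h N x \<partial>M) \<le> L2_norm M (h N)" for N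
  proof -
    have "norm (\<integral>x. f x * h N x \<partial>M) \<le> L2_norm M (\<lambda>x. f x * h N x)"
      by (rule L2_integrable(3)[OF fh])
    also have "\<dots> \<le> L2_norm M (h N)"
      unfolding L2_norm_def
      by (intro real_sqrt_le_mono integral_mono L2_integrable_sq fh h)
         (auto simp: f_def indicator_def norm_mult)
    finally show ?thesis .
  qed
  have eq: "(\<integral>x. f x * h N x \<partial>M) = of_real
     ((\<Sum>v\<in>QP N. prob (A \<inter> T v ` A)) / real (card (QP N :: (int ^ 'd) set)) - (prob A)\<^sup>2)" for N
  proof -
    have ind: "f x * translate T v f x = indicator (A \<inter> T v ` A) x" if "x \<in> space M" for x v
      using T_image_sets(2)[OF A that, of v] by (auto simp: f_def translate_def indicator_def)
    have "(\<integral>x. f x * h N x \<partial>M) = (\<integral>x. (\<Sum>v\<in>QP N. indicator (A \<inter> T v ` A) x)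
        / of_nat (card (QP N :: (int ^ 'd) set)) - f x * of_real (prob A) \<partial>M)"
      by (intro Bochner_Integration.integral_cong)
         (simp_all add: h_def primitive_average_def right_diff_distrib sum_distrib_left ind)
    also have "\<dots> = (\<Sum>v\<in>QP N. of_real (prob (A \<inter> T v ` A)))
        / of_nat (card (QP N :: (int ^ 'd) set)) - of_real (prob A) * of_real (prob A)"
    proof -
      have "A \<inter> T v ` A \<in> sets M" for v using A T_image_sets(1)[OF A] by (intro sets.Int)
      note ind_int = integral_complex_indicator[OF this]
      show ?thesis using ind_int(1) L2_integrable(1)[OF f] by (simp add: int_f ind_int(2))
    qed
    finally show ?thesis by (simp add: power2_eq_square)
  qed
  have "(\<lambda>N. (\<Sum>v\<in>QP N. prob (A \<inter> T v ` A)) / real (card (QP N :: (int ^ 'd) set)) - (prob A)\<^sup>2) \<longlonglongrightarrow> 0"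
    by (rule Lim_null_comparison[OF always_eventually lim])
       (use bound in \<open>simp add: eq norm_of_real flip: of_real_diff\<close>)
  thus ?thesis by (simp add: LIM_zero_iff)
qed

text \<open>
  The correlations are at most \<open>1\<close>. If they exceeded \<open>prob A ^ 2 - \<epsilon>\<close> only on a set of small
  density, their average would stay below its limit \<open>prob A ^ 2\<close>.
\<close>

lemma recurrence_density:
  assumes d: "CARD('d) \<ge> 2" and erg: "totally_ergodic M T"
    and A: "A \<in> sets M" "prob A > 0" and \<epsilon>: "\<epsilon> > 0"
  shows "lower_density_QP {v \<in> primitive_vectors. prob (A \<inter> T v ` A) > (prob A)\<^sup>2 - \<epsilon>} > 0"
proof -
  define E where "E = {v \<in> primitive_vectors. prob (A \<inter> T v ` A) > (prob A)\<^sup>2 - \<epsilon>}"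
  define p where "p N = real (card (QP N :: (int ^ 'd) set))" for N
  \<comment> \<open>Outside \<open>E\<close> the correlation is at most \<open>\<delta>\<close>. The truncation at \<open>0\<close> keeps \<open>\<delta>\<close> a non-negative
    bound when \<open>\<epsilon>\<close> exceeds \<open>prob A ^ 2\<close>, and \<open>prob A > 0\<close> still makes \<open>\<delta>\<close> smaller than the limit.\<close>
  define \<delta> where "\<delta> = max 0 ((prob A)\<^sup>2 - \<epsilon>)"
  define c where "c = (prob A)\<^sup>2 - \<delta>"
  have c: "c > 0" using A(2) \<epsilon> by (simp add: c_def \<delta>_def)
  have "\<forall>\<^sub>F N in sequentially. (\<Sum>v\<in>QP N. prob (A \<inter> T v ` A)) / p N > (prob A)\<^sup>2 - c / 2"
    unfolding p_def using c by (intro order_tendstoD(1)[OF correlation_average[OF d erg A(1)]]) simp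
  moreover have "\<forall>\<^sub>F N in sequentially. N > (0::nat)" by (rule eventually_gt_at_top)
  ultimately have "\<forall>\<^sub>F N in sequentially. ereal (c / 2) \<le> ereal (real (card (E \<inter> QP N)) / p N)"
  proof eventually_elim
    case (elim N)
    have p: "p N > 0" using card_QP_pos[OF d elim(2)] by (simp add: p_def)
    have "(\<Sum>v\<in>QP N. prob (A \<inter> T v ` A)) \<le> (\<Sum>v\<in>QP N. (if v \<in> E then 1 else 0) + \<delta>)"
    proof (rule sum_mono)
      fix v assume "v \<in> (QP N :: (int ^ 'd) set)"
      hence "v \<notin> E \<Longrightarrow> prob (A \<inter> T v ` A) \<le> \<delta>" by (auto simp: E_def QP_def \<delta>_def)
      moreover have "\<delta> \<ge> 0" by (simp add: \<delta>_def)
      moreover from this have "prob (A \<inter> T v ` A) \<le> 1 + \<delta>"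
        using prob_le_1[of "A \<inter> T v ` A"] by linarith
      ultimately show "prob (A \<inter> T v ` A) \<le> (if v \<in> E then 1 else 0) + \<delta>" by simp
    qed
    also have "\<dots> = real (card (E \<inter> QP N)) + p N * \<delta>"
      by (simp add: sum.distrib p_def sum.If_cases Int_commute)
    finally have "(\<Sum>v\<in>QP N. prob (A \<inter> T v ` A)) / p N
        \<le> (real (card (E \<inter> QP N)) + p N * \<delta>) / p N"
      using p by (intro divide_right_mono) auto
    also have "\<dots> = real (card (E \<inter> QP N)) / p N + \<delta>"
      using p by (simp add: field_simps)
    finally have "(prob A)\<^sup>2 - c / 2 < real (card (E \<inter> QP N)) / p N + \<delta>"
      by (rule less_le_trans[OF elim(1)])
    moreover have "c / 2 \<le> R" if "(prob A)\<^sup>2 - c / 2 < R + \<delta>" for R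
      using that by (simp add: c_def field_simps)
    ultimately have "c / 2 \<le> real (card (E \<inter> QP N)) / p N" by blast
    thus ?case by simp
  qed
  hence "ereal (c / 2) \<le> lower_density_QP E"
    unfolding lower_density_QP_def p_def by (rule Liminf_bounded)
  moreover have "0 < ereal (c / 2)" using c by simp
  ultimately show ?thesis unfolding E_def by (rule order_less_le_trans[rotated])
qed

end

theorem corollary1p1:
  fixes M :: "'a measure"
    and T :: "int ^ 'd \<Rightarrow> 'a \<Rightarrow> 'a"
    and f :: "'a \<Rightarrow> complex"
  assumes "CARD('d) \<ge> 2"
    and "pp_action M T"
    and "totally_ergodic M T"
    and "f \<in> L2 M"
  shows "L2_converges M (primitive_average T f) (\<lambda>_. \<integral>x. f x \<partial>M) \<and>
    (\<forall>A\<in>sets M. measure M A > 0 \<longrightarrow>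
      (\<forall>\<epsilon>>0. lower_density_QP
        {v \<in> primitive_vectors. measure M (A \<inter> T v ` A) > (measure M A)\<^sup>2 - \<epsilon>} > 0))"
proof -
  interpret pp_action M T by fact
  show ?thesis
    using primitive_average_converges[OF assms(1,3,4)] recurrence_density[OF assms(1,3)]
    by (intro conjI ballI impI allI)
qed

end
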